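(* Let $\mathbf p$ be a domino type partition of $2n$. Then the H-algorithm of type $C$ applied to $\mathbf p$ produces the special partition $\mathbf p^s$ of type $C_n$ attached to $\mathbf p$.
   Context: A domino type partition of $2n$ is a partition equal to the shape of the Robinson–Schensted (row insertion) tableau of ${}^-w=(-w(n),\dots,-w(1),w(1),\dots,w(n))$ for some signed permutation $w$ of $\{\pm1,\dots,\pm n\}$. The special partition $\mathbf p^s$. A $B$-symbol is a class of arrays $\binom{\lambda_1<\dots<\lambda_{m+1}}{\mu_1<\dots<\mu_m}$ of nonnegative integers modulo the shift to $\binom{0,\lambda_1+1,\dots,\lambda_{m+1}+1}{0,\mu_1+1,\dots,\mu_m+1}$; it is special if $\lambda_1\le\mu_1\le\lambda_2\le\mu_2\le\dots\le\mu_m\le\lambda_{m+1}$. A domino type partition $\mathbf p=[p_1,p_2,\dots]$ (extended by zeros, $m$ with $p_{2m+2}=0$) has a $B$-symbol $\Lambda$ determined by the equality of multisets $\{2\lambda_i,2\mu_j+1\}=\{p_k+2m+1-k\mid 1\le k\le2m+1\}$. Let $\Lambda^s$ be the unique special symbol with the same multiset of entries. A type $C$ partition $\mathbf d=[d_1,\dots,d_k]$ of $2n$ (odd parts with even multiplicity; $k=2m+1$ made odd by appending $0$ if needed) has the symbol with $\{2\lambda_i,2\mu_j+1\}=\{d_l+k-l\mid1\le l\le k\}$. $\mathbf p^s$ is the type $C$ partition of $2n$ whose symbol is $\Lambda^s$. H-algorithm of type $C$. Let $P$ be the Young diagram of $\mathbf p$. The box $(k,l)$ (row $k$, column $l$)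 is even (E) if $k+l$ is even, odd (O) otherwise. (1) Form $P^{\mathrm{odd}}$, the set of odd boxes of $P$, with the rows of $P$ remembered. (2) Label the rows from the top by $1,2,3,\dots$, but skip every pair of consecutive rows $i,i+1$ of equal length in $P$ such that the last box of row $i$ is E and the last box of row $i+1$ is O (i.e. in $P^{\mathrm{odd}}$ the last box of row $i+1$ is one column to the right of that of row $i$). (3) Keep odd labeled rows unchanged and put an E on the end of each even labeled row (immediately to the right of its last remaining box). (4) Fill the holes, i.e. take the smallest Young diagram containing all boxes; this is the output. *)

theory Defs
  imports Main "HOL-Library.Multiset"
begin

definition is_partition :: "nat list \<Rightarrow> bool" where
  "is_partition p \<longleftrightarrow> sorted_wrt (\<ge>) p \<and> 0 \<notin> set p"

definition is_partition_of :: "nat \<Rightarrow> nat list \<Rightarrow> bool" where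
  "is_partition_of N p \<longleftrightarrow> is_partition p \<and> sum_list p = N"

text \<open>Parts are numbered from 1 and extended by zeros (\<open>part p 0 = 0\<close> is a dummy value).\<close>

definition part :: "nat list \<Rightarrow> nat \<Rightarrow> nat" where
  "part p k = (if 1 \<le> k \<and> k \<le> length p then p ! (k - 1) else 0)"

definition young_diagram :: "nat list \<Rightarrow> (nat \<times> nat) set" where
  "young_diagram p = {(k, l). 1 \<le> k \<and> 1 \<le> l \<and> l \<le> part p k}"

fun row_insert :: "int \<Rightarrow> int list \<Rightarrow> int list \<times> int option" where
  "row_insert x [] = ([x], None)"
| "row_insert x (y # ys) =
     (if x < y then (x # ys, Some y)
      else (case row_insert x ys of (zs, b) \<Rightarrow> (y # zs, b)))"

fun tableau_insert :: "int \<Rightarrow> int list list \<Rightarrow> int list list" where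
  "tableau_insert x [] = [[x]]"
| "tableau_insert x (r # rs) =
     (case row_insert x r of
        (r', None) \<Rightarrow> r' # rs
      | (r', Some y) \<Rightarrow> r' # tableau_insert y rs)"

definition rs_tableau :: "int list \<Rightarrow> int list list" where
  "rs_tableau xs = foldl (\<lambda>T x. tableau_insert x T) [] xs"

definition shape :: "int list list \<Rightarrow> nat list" where
  "shape T = map length T"

definition signed_perm :: "nat \<Rightarrow> (int \<Rightarrow> int) \<Rightarrow> bool" where
  "signed_perm n w \<longleftrightarrow>
     bij_betw w ({- int n..int n} - {0}) ({- int n..int n} - {0}) \<and>
     (\<forall>i \<in> {- int n..int n} - {0}. w (- i) = - w i)"

definition minus_word :: "nat \<Rightarrow> (int \<Rightarrow> int) \<Rightarrow> int list" where
  "minus_word n w = map (\<lambda>i. - w i) (rev [1..int n]) @ map w [1..int n]"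

definition domino_type :: "nat \<Rightarrow> nat list \<Rightarrow> bool" where
  "domino_type n p \<longleftrightarrow>
     is_partition_of (2 * n) p \<and>
     (\<exists>w. signed_perm n w \<and> p = shape (rs_tableau (minus_word n w)))"

type_synonym barray = "nat list \<times> nat list"

definition barrays :: "barray set" where
  "barrays = {(ls, ms). sorted_wrt (<) ls \<and> sorted_wrt (<) ms \<and> length ls = length ms + 1}"

fun shift :: "barray \<Rightarrow> barray" where
  "shift (ls, ms) = (0 # map Suc ls, 0 # map Suc ms)"

definition shift_equiv :: "(barray \<times> barray) set" where
  "shift_equiv =
     {(A, B). A \<in> barrays \<and> B \<in> barrays \<and> (\<exists>i j. (shift ^^ i) A = (shift ^^ j) B)}"

lemma equiv_shift_equiv: "equiv barrays shift_equiv"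
proof (rule equivI)
  show "shift_equiv \<subseteq> barrays \<times> barrays"
    by (auto simp: shift_equiv_def)
  show "refl_on barrays shift_equiv"
    by (auto simp: refl_on_def shift_equiv_def)
  show "sym shift_equiv"
    unfolding sym_def shift_equiv_def by (auto; metis)
  show "trans shift_equiv"
  proof (rule transI)
    fix A B C
    assume "(A, B) \<in> shift_equiv" "(B, C) \<in> shift_equiv"
    then obtain i j k l where
      mem: "A \<in> barrays" "C \<in> barrays" and
      eq: "(shift ^^ i) A = (shift ^^ j) B" "(shift ^^ k) B = (shift ^^ l) C"
      by (auto simp: shift_equiv_def)
    have "(shift ^^ (k + i)) A = (shift ^^ (k + j)) B"
      using eq(1) by (simp add: funpow_add)
    also have "\<dots> = (shift ^^ (j + k)) B"
      by (simp add: add.commute)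
    also have "\<dots> = (shift ^^ (j + l)) C"
      using eq(2) by (simp add: funpow_add)
    finally show "(A, C) \<in> shift_equiv"
      using mem by (auto simp: shift_equiv_def)
  qed
qed

definition B_symbols :: "barray set set" where
  "B_symbols = barrays // shift_equiv"

definition entries :: "barray \<Rightarrow> nat multiset" where
  "entries A = mset (fst A) + mset (snd A)"

definition special_array :: "barray \<Rightarrow> bool" where
  "special_array A \<longleftrightarrow>
     (\<forall>i < length (snd A). fst A ! i \<le> snd A ! i \<and> snd A ! i \<le> fst A ! Suc i)"

text \<open>
  Entries of two classes can only be compared on arrays of the same size. As the multiset of
  entries has an odd number \<open>2 * m + 1\<close> of elements which determines \<open>m\<close>, equality of multisets
  selects representatives of the same size.
\<close>

definition special_symbol_of :: "barray set \<Rightarrow> barray set \<Rightarrow> bool" where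
  "special_symbol_of L S \<longleftrightarrow>
     L \<in> B_symbols \<and> S \<in> B_symbols \<and>
     (\<exists>A \<in> L. \<exists>B \<in> S. entries B = entries A \<and> special_array B)"

definition doubled_entries :: "barray \<Rightarrow> nat multiset" where
  "doubled_entries A =
     image_mset (\<lambda>x. 2 * x) (mset (fst A)) + image_mset (\<lambda>y. 2 * y + 1) (mset (snd A))"

definition beta_numbers :: "nat \<Rightarrow> nat list \<Rightarrow> nat multiset" where
  "beta_numbers K p = image_mset (\<lambda>k. part p k + K - k) (mset_set {1..K})"

definition symbol_of_domino :: "nat list \<Rightarrow> barray set \<Rightarrow> bool" where
  "symbol_of_domino p L \<longleftrightarrow>
     L \<in> B_symbols \<and>
     (\<exists>m. part p (2 * m + 2) = 0 \<and>
        (\<exists>A \<in> L. doubled_entries A = beta_numbers (2 * m + 1) p))"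

definition type_C :: "nat \<Rightarrow> nat list \<Rightarrow> bool" where
  "type_C n d \<longleftrightarrow> is_partition_of (2 * n) d \<and> (\<forall>x. odd x \<longrightarrow> even (count_list d x))"

definition symbol_of_type_C :: "nat list \<Rightarrow> barray set \<Rightarrow> bool" where
  "symbol_of_type_C d L \<longleftrightarrow>
     L \<in> B_symbols \<and>
     (let K = (if odd (length d) then length d else length d + 1)
      in \<exists>A \<in> L. doubled_entries A = beta_numbers K d)"

definition is_special_partition_of :: "nat \<Rightarrow> nat list \<Rightarrow> nat list \<Rightarrow> bool" where
  "is_special_partition_of n p d \<longleftrightarrow>
     type_C n d \<and>
     (\<exists>L S. symbol_of_domino p L \<and> special_symbol_of L S \<and> symbol_of_type_C d S)"

definition special_partition :: "nat \<Rightarrow> nat list \<Rightarrow> nat list" where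
  "special_partition n p = (THE d. is_special_partition_of n p d)"

definition even_box :: "nat \<times> nat \<Rightarrow> bool" where
  "even_box b \<longleftrightarrow> even (fst b + snd b)"

definition odd_boxes :: "nat list \<Rightarrow> (nat \<times> nat) set" where
  "odd_boxes p = {b \<in> young_diagram p. \<not> even_box b}"

definition skipped_pair :: "nat list \<Rightarrow> nat \<Rightarrow> bool" where
  "skipped_pair p i \<longleftrightarrow>
     1 \<le> i \<and> i + 1 \<le> length p \<and> part p i = part p (i + 1) \<and>
     even_box (i, part p i) \<and> \<not> even_box (i + 1, part p (i + 1))"

definition labeled_row :: "nat list \<Rightarrow> nat \<Rightarrow> bool" where
  "labeled_row p i \<longleftrightarrow>
     1 \<le> i \<and> i \<le> length p \<and> \<not> skipped_pair p i \<and> \<not> (2 \<le> i \<and> skipped_pair p (i - 1))"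

definition row_label :: "nat list \<Rightarrow> nat \<Rightarrow> nat" where
  "row_label p i = card {j \<in> {1..i}. labeled_row p j}"

text \<open>
  Skipped rows come in adjacent pairs, so the label of a labeled row \<open>i\<close> has the parity of \<open>i\<close>.
  Hence an even labeled row contains the odd box \<open>(i, 1)\<close>, and the maximum below is taken over a
  nonempty set.
\<close>

definition added_boxes :: "nat list \<Rightarrow> (nat \<times> nat) set" where
  "added_boxes p =
     {(i, Max {l. (i, l) \<in> odd_boxes p} + 1) | i. labeled_row p i \<and> even (row_label p i)}"

definition fill_holes :: "(nat \<times> nat) set \<Rightarrow> (nat \<times> nat) set" where
  "fill_holes X = \<Inter> {young_diagram q | q. is_partition q \<and> X \<subseteq> young_diagram q}"

definition H_algorithm_C :: "nat list \<Rightarrow> (nat \<times> nat) set" where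
  "H_algorithm_C p = fill_holes (odd_boxes p \<union> added_boxes p)"

end

theory Submission
  imports Defs
begin

text \<open>
  A domino type partition has an empty 2-core. By induction one removes the largest letter \<open>n\<close> and
  the smallest letter \<open>- n\<close> from the word. Reversing and negating a word preserves the shape of its
  tableau, so the removal of \<open>n\<close> and that of \<open>- n\<close>, which is a jeu de taquin slide, delete the same
  box, and this forces the two deleted boxes to form a domino.

  An empty 2-core means that the numbers \<open>p\<^sub>k + 2m + 1 - k\<close> consist of \<open>m + 1\<close> even and \<open>m\<close> odd ones,
  so the symbol exists. Its entries are their halves, already sorted, and the special symbol
  puts them alternately into its two rows. Reading off the partition rounds \<open>p\<^sub>k\<close> down to
  an even number for odd \<open>k\<close> and up for even \<open>k\<close>, except where two entries coincide. These are
  the row lengths which the H-algorithm produces.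
\<close>

section \<open>Row insertion\<close>

text \<open>Insertion shows directly how a tableau changes when letters are added at the end of a
  word, whereas the induction deletes the extreme letters \<open>n\<close> and \<open>- n\<close>
  wherever they stand. Knuth equivalence bridges this gap: it is compatible with deleting all
  letters outside an interval, so a word may be replaced by the reading word of its tableau, and
  both deletions become operations on the tableau alone.

  The 2-core itself is never computed. One integer, \<open>balance\<close>, is enough, because it
  determines how many more even than odd beta numbers there are.

  A second obstacle is that symbols are classes of arrays, and the definitions supply
  representatives of unrelated sizes. Uniqueness of the special partition is therefore proved after
  shifting all representatives to one common large size, where arrays of the same class
  coincide.\<close>

fun feed :: "int list \<Rightarrow> int list \<Rightarrow> int list" where
  "feed r [] = r"
| "feed r (x # xs) = feed (fst (row_insert x r)) xs"

fun bump :: "int list \<Rightarrow> int list \<Rightarrow> int list" where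
  "bump r [] = []"
| "bump r (x # xs) =
     (case snd (row_insert x r) of None \<Rightarrow> [] | Some y \<Rightarrow> [y]) @ bump (fst (row_insert x r)) xs"

abbreviation insert_word :: "int list list \<Rightarrow> int list \<Rightarrow> int list list" where
  "insert_word T xs \<equiv> foldl (\<lambda>T x. tableau_insert x T) T xs"

lemma feed_append: "feed r (xs @ ys) = feed (feed r xs) ys"
  by (induction xs arbitrary: r) auto

lemma bump_append: "bump r (xs @ ys) = bump r xs @ bump (feed r xs) ys"
  by (induction xs arbitrary: r) auto

text \<open>A row is not affected by what happens below it, so the lower rows receive exactly the
  word of letters that it ejects. Statements about tableaux thus reduce to a single row and an
  induction on the ejected word.\<close>

lemma insert_word_Cons: "insert_word (r # rs) xs = feed r xs # insert_word rs (bump r xs)"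
  by (induction xs arbitrary: r rs) (auto split: prod.split option.split)

lemma rs_tableau_rec:
  assumes "xs \<noteq> []"
  shows "rs_tableau xs = feed [] xs # rs_tableau (bump [] xs)"
proof -
  obtain x ys where "xs = x # ys" using assms by (cases xs) auto
  then show ?thesis by (simp add: rs_tableau_def insert_word_Cons)
qed

lemma rs_tableau_append: "rs_tableau (xs @ ys) = insert_word (rs_tableau xs) ys"
  by (simp add: rs_tableau_def)

lemma row_insert_append:
  "\<forall>a\<in>set A. a < x \<Longrightarrow> row_insert x (A @ B) = (A @ fst (row_insert x B), snd (row_insert x B))"
  by (induction A) (auto split: prod.split)

lemma row_insert_append_left:
  "\<exists>y\<in>set A. x < y \<Longrightarrow> row_insert x (A @ B) = (fst (row_insert x A) @ B, snd (row_insert x A))"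
proof (induction A)
  case (Cons a A)
  then show ?case by (cases "x < a") (auto simp: split_beta)
qed simp

lemma mset_add_distinct: "mset u + mset w = mset v \<Longrightarrow> distinct v \<Longrightarrow> distinct u \<and> distinct w"
  by (metis distinct_append mset_append mset_eq_imp_distinct_iff)

lemma row_insert_mset:
  "mset (fst (row_insert x r)) + mset (case snd (row_insert x r) of None \<Rightarrow> [] | Some y \<Rightarrow> [y])
     = add_mset x (mset r)"
  by (induction r) (auto split: prod.split option.split)

lemma feed_bump_mset: "mset (feed r xs) + mset (bump r xs) = mset r + mset xs"
proof (induction xs arbitrary: r)
  case (Cons x xs)
  show ?case using Cons[of "fst (row_insert x r)"] row_insert_mset[of x r]
    by (simp add: ac_simps) (metis add.assoc add.commute add_mset_add_single)
qed auto

lemma row_insert_cases: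
  assumes "sorted_wrt (<) r" "x \<notin> set r"
  obtains (app) "\<forall>a\<in>set r. a < x" "row_insert x r = (r @ [x], None)"
  | (bump) A y B where "r = A @ y # B" "\<forall>a\<in>set A. a < x" "x < y"
      "row_insert x r = (A @ x # B, Some y)"
proof (cases "\<forall>a\<in>set r. a < x")
  case True
  then show ?thesis using app row_insert_append[of r x "[]"] by simp
next
  case False
  then have "\<exists>a\<in>set r. x < a" using assms(2) by (metis linorder_neqE)
  then obtain A y B where "r = A @ y # B" "x < y" "\<forall>a\<in>set A. \<not> x < a"
    by (rule split_list_first_propE)
  moreover from this have "\<forall>a\<in>set A. a < x" using assms(2) by (metis Un_iff linorder_neqE set_append)
  ultimately show ?thesis using bump row_insert_append[of A x "y # B"] by simp
qed

lemma row_insert_sorted: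
  assumes "sorted_wrt (<) r" "x \<notin> set r"
  shows "sorted_wrt (<) (fst (row_insert x r))"
  using assms by (cases rule: row_insert_cases) (use assms in \<open>auto simp: sorted_wrt_append\<close>)

lemma distinct_row_insert:
  assumes "distinct (r @ x # xs)"
  shows "distinct (fst (row_insert x r) @ xs)"
proof -
  have "mset (fst (row_insert x r) @ xs) +
      mset (case snd (row_insert x r) of None \<Rightarrow> [] | Some y \<Rightarrow> [y]) = mset (r @ x # xs)"
    using row_insert_mset[of x r] by (simp add: ac_simps)
  then show ?thesis using assms mset_add_distinct by blast
qed

lemma feed_sorted:
  "sorted_wrt (<) r \<Longrightarrow> distinct (r @ xs) \<Longrightarrow> sorted_wrt (<) (feed r xs)"
proof (induction xs arbitrary: r)
  case (Cons x xs)
  then show ?case using row_insert_sorted[of r x] distinct_row_insert[of r x xs] by auto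
qed auto

lemma distinct_feed:
  assumes "distinct (r @ xs @ ys)" shows "distinct (feed r xs @ ys)"
  using assms
proof (induction xs arbitrary: r)
  case (Cons x xs)
  then show ?case using distinct_row_insert[of r x "xs @ ys"] by simp
qed auto

lemma distinct_bump:
  assumes "distinct (r @ xs)" shows "distinct (bump r xs)"
  using assms feed_bump_mset[of r xs] mset_add_distinct[of "feed r xs" "bump r xs" "r @ xs"] by simp

section \<open>Knuth equivalence\<close>

text \<open>Both relations exchange the neighbours \<open>x\<close> and \<open>z\<close>; the
  witness \<open>y\<close> of intermediate size stands to their left in \<open>K1\<close> and to
  their right in \<open>K2\<close>. Strict inequalities suffice for words without repeated
  letters.\<close>

inductive knuth :: "int list \<Rightarrow> int list \<Rightarrow> bool" where
  K1: "x < y \<Longrightarrow> y < z \<Longrightarrow> knuth (u @ [y, x, z] @ v) (u @ [y, z, x] @ v)"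
| K2: "x < y \<Longrightarrow> y < z \<Longrightarrow> knuth (u @ [x, z, y] @ v) (u @ [z, x, y] @ v)"

lemma knuth_context: "knuth u v \<Longrightarrow> knuth (a @ u @ b) (a @ v @ b)"
  by (induction rule: knuth.induct)
    (use K1[of _ _ _ "a @ _" "_ @ b"] K2[of _ _ _ "a @ _" "_ @ b"] in auto)

lemma knuth_mset: "knuth u v \<Longrightarrow> mset u = mset v"
  by (induction rule: knuth.induct) auto

text \<open>Once \<open>y\<close> is in the row it separates the other two: \<open>x\<close> acts at
  \<open>y\<close> or to its left, \<open>z\<close> to the right, so their insertions commute. If
  three letters are ejected, then x' \<le> y < y' < z', which is a \<open>K1\<close> relation again;
  if \<open>y\<close> or \<open>z\<close> ejects nothing, the ejected words are equal.\<close>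

lemma K1_row:
  assumes r: "sorted_wrt (<) r" "distinct (r @ [y, x, z])" and xyz: "x < y" "y < z"
  shows "feed r [y, x, z] = feed r [y, z, x]"
    and "bump r [y, x, z] = bump r [y, z, x] \<or> knuth (bump r [y, x, z]) (bump r [y, z, x])"
proof -
  obtain A B b where y: "row_insert y r = (A @ y # B, b)" "\<forall>a\<in>set A. a < y"
    and b: "(b = None \<and> B = [] \<and> r = A) \<or> (\<exists>y'. b = Some y' \<and> r = A @ y' # B \<and> y < y')"
  proof -
    have "y \<notin> set r" using r by simp
    with r(1) show ?thesis
    proof (cases rule: row_insert_cases)
      case app
      then show ?thesis using that[of r "[]" None] by simp
    next
      case (bump A y' B)
      then show ?thesis using that[of A B "Some y'"] by simp
    qed
  qed
  have srt: "sorted_wrt (<) (A @ [y])"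
    using row_insert_sorted[of r y] r y by (auto simp: sorted_wrt_append)
  have xA: "x \<notin> set A" "z \<notin> set A" "z \<notin> set B" using b r by auto
  obtain A' x' where x: "row_insert x (A @ [y]) = (A', Some x')" "x' \<le> y" "set A' \<subseteq> insert x (set (A @ [y]))"
  proof -
    have "x \<notin> set (A @ [y])" using xA xyz by simp
    with srt show ?thesis
    proof (cases rule: row_insert_cases)
      case app
      then show ?thesis using xyz by simp
    next
      case (bump E w F)
      have "set (A @ [y]) = set (E @ w # F)" using bump(1) by metis
      then have "w \<in> set (A @ [y])" "set (E @ x # F) \<subseteq> insert x (set (A @ [y]))" by auto
      moreover have "w \<le> y" using calculation(1) y(2) by auto
      ultimately show ?thesis using bump that by simp
    qed
  qed
  have 1: "row_insert x (A @ y # B') = (A' @ B', Some x')" for B'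
    using row_insert_append_left[of "A @ [y]" x B'] x xyz by simp
  have 2: "row_insert z (A @ y # B) = (A @ y # fst (row_insert z B), snd (row_insert z B))"
    using row_insert_append[of "A @ [y]" z B] y xyz by (force)
  have 3: "row_insert z (A' @ B) = (A' @ fst (row_insert z B), snd (row_insert z B))"
    by (rule row_insert_append) (use x y xyz in force)
  show "feed r [y, x, z] = feed r [y, z, x]" by (simp add: y 1 2 3)
  show "bump r [y, x, z] = bump r [y, z, x] \<or> knuth (bump r [y, x, z]) (bump r [y, z, x])"
  proof (cases b)
    case None
    then have "B = []" using b by auto
    then have "row_insert z (A @ [y]) = (A @ [y, z], None)" "row_insert z A' = (A' @ [z], None)"
      using 2 3 by simp_all
    then show ?thesis using \<open>B = []\<close> \<open>b = None\<close> y(1) 1[of "[]"] 1[of "[z]"] by simp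
  next
    case (Some y')
    then have rr: "r = A @ y' # B" "y < y'" using b by auto
    have sB: "sorted_wrt (<) B" "\<forall>c\<in>set B. y' < c" using r rr by (auto simp: sorted_wrt_append)
    show ?thesis
    proof (cases "snd (row_insert z B)")
      case None
      then show ?thesis by (simp add: y 1 2 3)
    next
      case (Some z')
      have "z' \<in> set B" using sB(1) xA(3) by (cases rule: row_insert_cases) (use Some in auto)
      then have "x' < y'" "y' < z'" using sB x rr by auto
      then show ?thesis using K1[of x' y' z' "[]" "[]"] Some \<open>b = Some y'\<close> by (simp add: y 1 2 3)
    qed
  qed
qed

text \<open>The row is cut into its letters below \<open>x\<close>, between \<open>x\<close> and
  \<open>z\<close>, and above \<open>z\<close>. If the middle block is empty, \<open>x\<close> and
  \<open>z\<close> compete for the same place, and three ejected letters are related by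
  \<open>K1\<close> in the opposite direction, whence the third disjunct. Otherwise they act on
  different blocks and a \<open>K2\<close> relation survives.\<close>

lemma K2_row:
  assumes r: "sorted_wrt (<) r" "distinct (r @ [x, z, y])" and xyz: "x < y" "y < z"
  shows "feed r [x, z, y] = feed r [z, x, y]"
    and "bump r [x, z, y] = bump r [z, x, y] \<or> knuth (bump r [x, z, y]) (bump r [z, x, y])
          \<or> knuth (bump r [z, x, y]) (bump r [x, z, y])"
proof -
  define A where "A = filter (\<lambda>a. a < x) r"
  define C where "C = filter (\<lambda>a. x < a \<and> a < z) r"
  define B where "B = filter (\<lambda>a. z < a) r"
  have rr: "r = A @ C @ B"
  proof -
    have "sorted_wrt (<) (A @ C @ B)"
      using r xyz unfolding A_def B_def C_def by (auto simp: sorted_wrt_append sorted_wrt_filter)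
    moreover have "set (A @ C @ B) = set r" using r xyz unfolding A_def B_def C_def
      by (auto simp: not_less order.order_iff_strict)
    ultimately show ?thesis using r(1) strict_sorted_equal by blast
  qed
  have A: "\<forall>a\<in>set A. a < x" and C: "\<forall>a\<in>set C. x < a \<and> a < z" and B: "\<forall>a\<in>set B. z < a"
    unfolding A_def B_def C_def by auto
  have Ax: "row_insert x (A @ D) = (A @ fst (row_insert x D), snd (row_insert x D))"
    "row_insert y (A @ D) = (A @ fst (row_insert y D), snd (row_insert y D))"
    "row_insert z (A @ D) = (A @ fst (row_insert z D), snd (row_insert z D))" for D
    by (rule row_insert_append; use A xyz in force)+
  note Ax' = Ax Ax[of "[]", simplified]
  have "feed r [x, z, y] = feed r [z, x, y] \<and> (bump r [x, z, y] = bump r [z, x, y] \<or> knuth (bump r [x, z, y]) (bump r [z, x, y])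
          \<or> knuth (bump r [z, x, y]) (bump r [x, z, y]))"
  proof (cases C)
    case Nil
    show ?thesis
    proof (cases B)
      case Nil
      then show ?thesis using \<open>C = []\<close> xyz by (simp add: rr Ax')
    next
      case (Cons b1 B')
      show ?thesis
      proof (cases B')
        case Nil
        then show ?thesis using \<open>C = []\<close> Cons B xyz by (simp add: rr Ax')
      next
        case (Cons b2 B'')
        have "b1 < b2" using r(1) \<open>B = b1 # B'\<close> Cons unfolding rr by (auto simp: sorted_wrt_append)
        then show ?thesis using \<open>C = []\<close> \<open>B = b1 # B'\<close> Cons B xyz K1[of z b1 b2 "[]" "[]"]
          by (simp add: rr Ax')
      qed
    qed
  next
    case (Cons c C')
    have Cz: "row_insert z (E @ D) = (E @ fst (row_insert z D), snd (row_insert z D))"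
      if "set E \<subseteq> insert x (set C)" for E D
      by (rule row_insert_append) (use that C xyz in force)
    have zB: "\<exists>B'. row_insert z B = (z # B', None) \<or> (\<exists>z'. row_insert z B = (z # B', Some z') \<and> z < z')"
      using B by (cases B) auto
    then obtain B' o' where zB: "row_insert z B = (z # B', o')" and o': "\<forall>z'. o' = Some z' \<longrightarrow> z < z'" by auto
    have sC: "sorted_wrt (<) (C' @ [z])" "\<forall>a\<in>set C'. c < a" "y \<notin> set (C' @ [z])"
      using r C Cons xyz unfolding rr by (auto simp: sorted_wrt_append)
    \<comment> \<open>To the right of the new \<open>x\<close> come \<open>C'\<close> and then
      \<open>z\<close>, so \<open>y\<close> certainly ejects a letter, and one that is at most
      \<open>z\<close>.\<close>
    obtain D y' where y: "row_insert y (C' @ [z]) = (D, Some y')" and y': "y' \<in> set (C' @ [z])"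
      using sC(1,3) xyz by (cases rule: row_insert_cases[of "C' @ [z]" y]) auto
    have yB: "row_insert y (C' @ z # B') = (D @ B', Some y')"
      using row_insert_append_left[of "C' @ [z]" y B'] y xyz by simp
    have cy: "c < y'" "y' \<le> z" using y' sC C Cons by auto
    have xz: "row_insert z (x # C' @ B) = (x # C' @ z # B', o')" "row_insert z (c # C' @ B) = (c # C' @ z # B', o')"
      using Cz[of "x # C'" B] Cz[of "c # C'" B] Cons zB by (auto simp del: row_insert.simps)
    have xc: "x < c" using C Cons by auto
    show ?thesis
    proof (cases o')
      case None
      then show ?thesis using Cons xyz xc xz yB by (simp add: rr Ax')
    next
      case (Some z')
      then show ?thesis using Cons xyz xc xz yB K2[of c y' z' "[]" "[]"] cy o' by (simp add: rr Ax')
    qed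
  qed
  then show "feed r [x, z, y] = feed r [z, x, y]"
    and "bump r [x, z, y] = bump r [z, x, y] \<or> knuth (bump r [x, z, y]) (bump r [z, x, y])
          \<or> knuth (bump r [z, x, y]) (bump r [x, z, y])" by blast+
qed

lemma knuth_row:
  assumes "knuth u v" "sorted_wrt (<) r" "distinct (r @ u)"
  shows "feed r u = feed r v \<and>
     (bump r u = bump r v \<or> knuth (bump r u) (bump r v) \<or> knuth (bump r v) (bump r u))"
  using assms
proof (induction rule: knuth.induct)
  case (K1 x y z u v)
  have s: "sorted_wrt (<) (feed r u)" using feed_sorted[of r u] K1.prems by auto
  have d: "distinct (feed r u @ [y, x, z])"
    using distinct_feed[of r u "[y, x, z]"] K1.prems by auto
  note k = K1_row[OF s d K1.hyps]
  then show ?case using knuth_context[of "bump (feed r u) [y,x,z]" "bump (feed r u) [y,z,x]" "bump r u"]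
    unfolding feed_append bump_append by metis
next
  case (K2 x y z u v)
  have s: "sorted_wrt (<) (feed r u)" using feed_sorted[of r u] K2.prems by auto
  have d: "distinct (feed r u @ [x, z, y])"
    using distinct_feed[of r u "[x, z, y]"] K2.prems by auto
  note k = K2_row[OF s d K2.hyps]
  then show ?case using knuth_context[of "bump (feed r u) [x,z,y]" "bump (feed r u) [z,x,y]" "bump r u"]
    knuth_context[of "bump (feed r u) [z,x,y]" "bump (feed r u) [x,z,y]" "bump r u"]
    unfolding feed_append bump_append by metis
qed

lemma length_bump: "u \<noteq> [] \<Longrightarrow> length (bump [] u) < length u"
proof -
  assume "u \<noteq> []"
  then have *: "feed [] u \<noteq> []"
  proof -
    have ne: "fst (row_insert x r) \<noteq> []" for x r by (cases r) (auto split: prod.split)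
    have "r \<noteq> [] \<Longrightarrow> feed r xs \<noteq> []" for r xs using ne by (induction xs arbitrary: r) auto
    then show ?thesis using \<open>u \<noteq> []\<close> ne by (cases u) auto
  qed
  have "length (feed [] u) + length (bump [] u) = length u"
    using arg_cong[OF feed_bump_mset[of "[]" u], of size] by simp
  then show ?thesis using * by (cases "feed [] u") auto
qed

lemma knuth_rs_tableau:
  assumes "knuth u v" "distinct u"
  shows "rs_tableau u = rs_tableau v"
  using assms
proof (induction "length u" arbitrary: u v rule: less_induct)
  case less
  have m: "mset u = mset v" using knuth_mset less.prems by blast
  have dv: "distinct v" using less.prems m by (metis mset_eq_imp_distinct_iff)
  show ?case
  proof (cases "u = []")
    case True
    then show ?thesis using m by simp
  next
    case False
    then have "v \<noteq> []" using m by auto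
    have k: "feed [] u = feed [] v" "bump [] u = bump [] v \<or> knuth (bump [] u) (bump [] v) \<or> knuth (bump [] v) (bump [] u)"
      using knuth_row[of u v "[]"] less.prems by auto
    have "rs_tableau (bump [] u) = rs_tableau (bump [] v)"
      using k(2) less.hyps[of "bump [] u" "bump [] v"] less.hyps[of "bump [] v" "bump [] u"]
        length_bump[OF False] length_bump[OF \<open>v \<noteq> []\<close>] distinct_bump[of "[]"] dv less.prems m
      by (metis append_Nil mset_eq_length)
    then show ?thesis using rs_tableau_rec False \<open>v \<noteq> []\<close> k(1) by metis
  qed
qed

section \<open>Knuth equivalence under restriction, reversal and insertion\<close>

abbreviation knuth_eq :: "int list \<Rightarrow> int list \<Rightarrow> bool" where
  "knuth_eq \<equiv> equivclp knuth"

lemma knuth_eq_rs_tableau: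
  assumes "knuth_eq u v" "distinct u"
  shows "rs_tableau u = rs_tableau v \<and> mset u = mset v"
  using assms
proof (induction rule: equivclp_induct)
  case (step y z)
  then have "distinct y" "distinct z" using knuth_mset by (metis mset_eq_imp_distinct_iff)+
  then show ?case using step knuth_rs_tableau knuth_mset by metis
qed auto

lemma knuth_eq_map:
  assumes "knuth_eq u v" and "\<And>a b. knuth a b \<Longrightarrow> knuth_eq (f a) (f b)"
  shows "knuth_eq (f u) (f v)"
  using assms(1)
proof (induction rule: equivclp_induct)
  case (step y z)
  then show ?case using assms(2) by (meson equivclp_sym equivclp_trans)
qed auto

lemma knuth_eq_context: "knuth_eq u v \<Longrightarrow> knuth_eq (a @ u @ b) (a @ v @ b)"
  by (rule knuth_eq_map[where f = "\<lambda>u. a @ u @ b"]) (auto intro: knuth_context r_into_equivclp)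

text \<open>An elementary relation exchanges only the smallest and the largest of three letters. If
  both survive, convexity of \<open>Q\<close> keeps the intermediate letter and with it the
  relation; if one is dropped, the filtered words coincide.\<close>

lemma knuth_eq_filter:
  assumes "knuth_eq u v" and conv: "\<And>x y z. x < y \<Longrightarrow> y < z \<Longrightarrow> Q x \<Longrightarrow> Q z \<Longrightarrow> Q y"
  shows "knuth_eq (filter Q u) (filter Q v)"
proof (rule knuth_eq_map[OF assms(1)])
  fix a b assume "knuth a b"
  then show "knuth_eq (filter Q a) (filter Q b)"
  proof cases
    case (K1 x y z u v)
    show ?thesis
      using knuth.K1[OF K1(3,4), of "filter Q u" "filter Q v"] conv[OF K1(3,4)] unfolding K1(1,2)
      by (cases "Q x"; cases "Q z") (auto intro: r_into_equivclp)
  next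
    case (K2 x y z u v)
    show ?thesis
      using knuth.K2[OF K2(3,4), of "filter Q u" "filter Q v"] conv[OF K2(3,4)] unfolding K2(1,2)
      by (cases "Q x"; cases "Q z") (auto intro: r_into_equivclp)
  qed
qed

definition revneg :: "int list \<Rightarrow> int list" where
  "revneg xs = rev (map uminus xs)"

lemma revneg_append [simp]: "revneg (xs @ ys) = revneg ys @ revneg xs"
  by (simp add: revneg_def)

lemma revneg_revneg [simp]: "revneg (revneg xs) = xs"
  by (simp add: revneg_def rev_map o_def)

lemma distinct_revneg [simp]: "distinct (revneg xs) = distinct xs"
  by (simp add: revneg_def distinct_map)

text \<open>Reversal combined with negation interchanges the two kinds of relations
  \<open>K1\<close> and \<open>K2\<close>.\<close>

lemma knuth_eq_revneg: "knuth_eq u v \<Longrightarrow> knuth_eq (revneg u) (revneg v)"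
proof (erule knuth_eq_map)
  fix a b assume "knuth a b"
  then show "knuth_eq (revneg a) (revneg b)"
  proof cases
    case (K1 x y z u v)
    then show ?thesis using knuth.K2[of "-z" "-y" "-x" "revneg v" "revneg u"]
      by (auto simp: revneg_def intro: equivclp_sym r_into_equivclp)
  next
    case (K2 x y z u v)
    then show ?thesis using knuth.K1[of "-z" "-y" "-x" "revneg v" "revneg u"]
      by (auto simp: revneg_def intro: equivclp_sym r_into_equivclp)
  qed
qed

text \<open>The letter \<open>x\<close> travels left through \<open>B\<close> by \<open>K1\<close>
  moves; the letter just before the exchanged pair is the intermediate one, and \<open>y\<close>
  supplies it for the last move.\<close>

lemma knuth_eq_move_left:
  assumes "x < y" "\<forall>b\<in>set B. y < b" "sorted_wrt (<) B"
  shows "knuth_eq (y # B @ [x]) (y # x # B)"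
  using assms(2,3)
proof (induction B rule: rev_induct)
  case (snoc b B)
  have "knuth_eq (y # B @ [x]) (y # x # B)" using snoc by (auto simp: sorted_wrt_append)
  then have 1: "knuth_eq (y # B @ [x] @ [b]) (y # x # B @ [b])"
    using knuth_eq_context[of _ _ "[]" "[b]"] by fastforce
  obtain B' c where c: "y # B = B' @ [c]" by (metis append_butlast_last_id list.distinct(1))
  have "c \<in> set (y # B)" unfolding c by simp
  then have "x < c" "c < b" using snoc assms(1) by (auto simp: sorted_wrt_append)
  then have "knuth (B' @ [c, x, b] @ []) (B' @ [c, b, x] @ [])" by (rule K1)
  then have "knuth_eq (y # B @ [b] @ [x]) (y # B @ [x] @ [b])"
    using c by (metis append.assoc append_Cons append_Nil equivclp_sym r_into_equivclp append_Nil2)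
  then show ?case using 1 by (metis append.assoc append_Cons append_Nil equivclp_trans)
qed simp

text \<open>Here \<open>y\<close> travels left through \<open>A\<close> by \<open>K2\<close> moves,
  the intermediate letter being the one just after the exchanged pair.\<close>

lemma knuth_eq_move_front:
  assumes "x < y" "\<forall>a\<in>set A. a < x" "sorted_wrt (<) A"
  shows "knuth_eq (A @ [y, x]) (y # A @ [x])"
  using assms(2,3)
proof (induction A)
  case (Cons a A)
  have "knuth_eq (A @ [y, x]) (y # A @ [x])" using Cons by (auto simp: sorted_wrt_append)
  then have 1: "knuth_eq (a # A @ [y, x]) (a # y # A @ [x])"
    using knuth_eq_context[of _ _ "[a]" "[]"] by fastforce
  obtain A' c where c: "A @ [x] = c # A'" by (cases A) auto
  have "c \<in> set (A @ [x])" unfolding c by simp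
  then have "a < c" "c < y" using Cons assms(1) by (auto simp: sorted_wrt_append)
  then have "knuth ([] @ [a, y, c] @ A') ([] @ [y, a, c] @ A')" by (rule K2)
  then have "knuth_eq (a # y # A @ [x]) (y # a # A @ [x])"
    using c by (simp add: r_into_equivclp)
  then show ?case using 1 by (metis append_Cons equivclp_trans)
qed simp

text \<open>The ejected letter is written in front of the row because a reading word lists lower
  rows first.\<close>

lemma knuth_eq_row_insert:
  assumes "sorted_wrt (<) r" "x \<notin> set r"
  shows "knuth_eq (r @ [x]) ((case snd (row_insert x r) of None \<Rightarrow> [] | Some y \<Rightarrow> [y]) @ fst (row_insert x r))"
  using assms
proof (cases rule: row_insert_cases)
  case (bump A y B)
  have 1: "knuth_eq (y # B @ [x]) (y # x # B)"
    by (rule knuth_eq_move_left) (use assms bump in \<open>auto simp: sorted_wrt_append\<close>)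
  have 2: "knuth_eq (A @ [y, x]) (y # A @ [x])"
    by (rule knuth_eq_move_front) (use assms bump in \<open>auto simp: sorted_wrt_append\<close>)
  show ?thesis using knuth_eq_context[OF 1, of A "[]"] knuth_eq_context[OF 2, of "[]" B] bump
    by (simp add: equivclp_trans)
qed auto

lemma knuth_eq_feed:
  "sorted_wrt (<) r \<Longrightarrow> distinct (r @ xs) \<Longrightarrow> knuth_eq (r @ xs) (bump r xs @ feed r xs)"
proof (induction xs arbitrary: r)
  case (Cons x xs)
  let ?r = "fst (row_insert x r)" let ?b = "case snd (row_insert x r) of None \<Rightarrow> [] | Some y \<Rightarrow> [y]"
  have "knuth_eq (?r @ xs) (bump ?r xs @ feed ?r xs)"
    using Cons row_insert_sorted[of r x] distinct_row_insert[of r x xs] by simp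
  from knuth_eq_context[OF this, of ?b "[]"] knuth_eq_context[OF knuth_eq_row_insert[of r x], of "[]" xs]
  show ?case using Cons.prems by (simp add: equivclp_trans)
qed auto

abbreviation reading_word :: "int list list \<Rightarrow> int list" where
  "reading_word T \<equiv> concat (rev T)"

lemma knuth_eq_reading_word:
  "distinct w \<Longrightarrow> knuth_eq w (reading_word (rs_tableau w))"
proof (induction "length w" arbitrary: w rule: less_induct)
  case less
  show ?case
  proof (cases "w = []")
    case True then show ?thesis by (simp add: rs_tableau_def)
  next
    case False
    have "knuth_eq (bump [] w) (reading_word (rs_tableau (bump [] w)))"
      using less length_bump[OF False] distinct_bump[of "[]" w] by simp
    from knuth_eq_context[OF this, of "[]" "feed [] w"] knuth_eq_feed[of "[]" w]
    show ?thesis using less rs_tableau_rec[OF False] by (simp add: equivclp_trans)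
  qed
qed

section \<open>Tableaux and their reading words\<close>

definition column_strict :: "int list \<Rightarrow> int list \<Rightarrow> bool" where
  "column_strict r s \<longleftrightarrow> length s \<le> length r \<and> (\<forall>j < length s. r ! j < s ! j)"

fun is_tableau :: "int list list \<Rightarrow> bool" where
  "is_tableau [] \<longleftrightarrow> True"
| "is_tableau (r # rs) \<longleftrightarrow>
     r \<noteq> [] \<and> sorted_wrt (<) r \<and> (rs \<noteq> [] \<longrightarrow> column_strict r (hd rs)) \<and> is_tableau rs"

lemma row_insert_index:
  assumes "sorted_wrt (<) r" "x \<notin> set r"
  obtains (app) "\<forall>a\<in>set r. a < x" "row_insert x r = (r @ [x], None)"
  | (bump) j where "j < length r" "\<forall>i<j. r ! i < x" "x < r ! j"
      "row_insert x r = (r[j := x], Some (r ! j))"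
  using assms
proof (cases rule: row_insert_cases)
  case (bump A y B)
  then show ?thesis using that(2)[of "length A"] by (auto simp: nth_append)
qed

text \<open>Below its old place the ejected letter had a larger letter or none, so it enters the
  next row weakly to the left of its old column. There the letter above it is smaller: either
  \<open>x\<close> or one of its former left neighbours.\<close>

lemma column_strict_row_insert:
  assumes "sorted_wrt (<) r" "x \<notin> set r" "row_insert x r = (r', Some y)"
    and s: "sorted_wrt (<) s" "y \<notin> set s" "column_strict r s"
  shows "column_strict r' (fst (row_insert y s))"
proof -
  obtain j where j: "j < length r" "\<forall>i<j. r ! i < x" "x < r ! j" "r' = r[j := x]" "y = r ! j"
    using assms(1,2) by (cases rule: row_insert_index) (use assms(3) in auto)
  have rr: "r ! i < r ! i'" if "i < i'" "i' < length r" for i i'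
    using assms(1) that by (simp add: sorted_wrt_nth_less)
  from s(1,2) show ?thesis
  proof (cases rule: row_insert_index)
    case app
    have "length s \<le> j"
    proof (rule ccontr)
      assume "\<not> length s \<le> j"
      then have "s ! j < y" "r ! j < s ! j" using app s(3) by (auto simp: column_strict_def)
      then show False using j by simp
    qed
    then show ?thesis using app j s(3) rr by (auto simp: column_strict_def nth_append nth_list_update less_Suc_eq)
  next
    case (bump i)
    have "i \<le> j"
    proof (rule ccontr)
      assume "\<not> i \<le> j"
      then have "s ! j < y" "r ! j < s ! j" using bump s(3) by (auto simp: column_strict_def)
      then show False using j by simp
    qed
    then show ?thesis using bump j s(3) rr[of i j]
      by (auto simp: column_strict_def nth_list_update intro: less_trans)
  qed
qed

lemma column_strict_append: "column_strict r s \<Longrightarrow> column_strict (r @ u) s"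
  by (auto simp: column_strict_def nth_append)

lemma is_tableau_insert:
  assumes "is_tableau T" "distinct (concat T @ [x])"
  shows "is_tableau (tableau_insert x T) \<and> mset (concat (tableau_insert x T)) = add_mset x (mset (concat T))
    \<and> hd (tableau_insert x T) = fst (row_insert x (hd (T @ [[]]))) \<and> tableau_insert x T \<noteq> []"
  using assms
proof (induction T arbitrary: x)
  case (Cons r rs)
  have r: "sorted_wrt (<) r" "x \<notin> set r" using Cons.prems by auto
  then show ?case
  proof (cases rule: row_insert_cases)
    case app
    then show ?thesis using Cons.prems r by (auto simp: column_strict_append sorted_wrt_append)
  next
    case (bump A y B)
    let ?T = "tableau_insert y rs" let ?r = "A @ x # B"
    have y: "distinct (concat rs @ [y])" "is_tableau rs" using Cons.prems bump by auto
    note IH = Cons.IH[OF y(2) y(1)]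
    have sr: "sorted_wrt (<) ?r" using row_insert_sorted[OF r] bump by simp
    have ab: "column_strict ?r (hd ?T)"
    proof (cases rs)
      case Nil
      then show ?thesis using bump(2,3) by (cases A) (auto simp: column_strict_def)
    next
      case (Cons s ss)
      have "column_strict ?r (fst (row_insert y s))"
        by (rule column_strict_row_insert[OF r]) (use Cons bump y Cons.prems in auto)
      then show ?thesis using IH Cons by simp
    qed
    show ?thesis using IH ab sr bump by auto
  qed
qed auto

lemma is_tableau_insert_word:
  "is_tableau T \<Longrightarrow> distinct (concat T @ w) \<Longrightarrow>
    is_tableau (insert_word T w) \<and> mset (concat (insert_word T w)) = mset (concat T) + mset w"
proof (induction w arbitrary: T)
  case (Cons x w)
  have t: "is_tableau (tableau_insert x T)" "mset (concat (tableau_insert x T)) = mset (concat T @ [x])"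
    using is_tableau_insert[of T x] Cons.prems by auto
  have "mset (concat (tableau_insert x T) @ w) = mset (concat T @ x # w)"
    using t(2) by simp
  then have "distinct (concat (tableau_insert x T) @ w)"
    using Cons.prems(2) by (metis mset_eq_imp_distinct_iff)
  then show ?case using Cons.IH[OF t(1)] t(2) by (simp add: ac_simps)
qed auto

lemma is_tableau_rs_tableau:
  "distinct w \<Longrightarrow> is_tableau (rs_tableau w) \<and> mset (concat (rs_tableau w)) = mset w"
  using is_tableau_insert_word[of "[]" w] by (simp add: rs_tableau_def)

text \<open>The word \<open>b\<close> sweeps through the row from left to right, each letter taking
  the next place and ejecting its occupant. The prefix \<open>c\<close> holds the letters already
  placed. The tail \<open>v\<close> stays untouched; it has to be empty if \<open>b\<close> outruns
  \<open>t\<close>, because the remaining letters are appended at the end.\<close>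

lemma feed_segment:
  assumes "sorted_wrt (<) (c @ b)" "\<forall>j < length t. b ! j < t ! j"
    and "length t = length b \<or> length t < length b \<and> v = []"
  shows "feed (c @ t @ v) b = c @ b @ v \<and> bump (c @ t @ v) b = t"
  using assms
proof (induction b arbitrary: c t)
  case (Cons x b)
  have cx: "\<forall>a\<in>set c. a < x" using Cons.prems by (auto simp: sorted_wrt_append)
  have s: "sorted_wrt (<) ((c @ [x]) @ b)" using Cons.prems by simp
  show ?case
  proof (cases t)
    case Nil
    then have "v = []" using Cons.prems by auto
    then have "row_insert x (c @ t @ v) = (c @ [x], None)" using row_insert_append[OF cx, of "[]"] Nil by simp
    moreover have "feed ((c @ [x]) @ [] @ []) b = (c @ [x]) @ b @ [] \<and> bump ((c @ [x]) @ [] @ []) b = []"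
      using Cons.IH[OF s, of "[]"] \<open>v = []\<close> by (cases b) auto
    ultimately show ?thesis using Nil \<open>v = []\<close> by simp
  next
    case (Cons y t')
    have "x < y" using Cons.prems(2) Cons by force
    then have "row_insert x (c @ t @ v) = ((c @ [x]) @ t' @ v, Some y)"
      using row_insert_append[OF cx, of "y # t' @ v"] Cons by simp
    moreover have "feed ((c @ [x]) @ t' @ v) b = (c @ [x]) @ b @ v \<and> bump ((c @ [x]) @ t' @ v) b = t'"
    proof (rule Cons.IH[OF s])
      show "\<forall>j<length t'. b ! j < t' ! j" using Cons.prems(2) Cons by fastforce
    qed (use Cons.prems(3) Cons in auto)
    ultimately show ?thesis using Cons by simp
  qed
qed auto

text \<open>By column strictness the inserted row ejects the former first row letter by letter and
  in order, so the whole tableau moves down by one row.\<close>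

lemma insert_word_row:
  "is_tableau (r # rs) \<Longrightarrow> insert_word rs r = r # rs"
proof (induction rs arbitrary: r)
  case Nil
  have *: "insert_word [] r = insert_word [[]] r" using Nil by (cases r) auto
  show ?case unfolding * insert_word_Cons using feed_segment[of "[]" r "[]" "[]"] Nil by auto
next
  case (Cons s ss)
  have *: "length s \<le> length r" "\<forall>j<length s. r ! j < s ! j"
    using Cons.prems by (auto simp: column_strict_def)
  then have "feed ([] @ s @ []) r = [] @ r @ [] \<and> bump ([] @ s @ []) r = s"
    by (intro feed_segment) (use Cons.prems in auto)
  then show ?case unfolding insert_word_Cons using Cons by simp
qed

lemma rs_tableau_reading_word: "is_tableau T \<Longrightarrow> rs_tableau (reading_word T) = T"
proof (induction T)
  case (Cons r rs)
  then show ?case by (simp add: rs_tableau_append insert_word_row)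
qed (simp add: rs_tableau_def)

lemma distinct_reading_word: "distinct (reading_word T) = distinct (concat T)"
  by (rule mset_eq_imp_distinct_iff) (simp add: mset_concat rev_map[symmetric] sum_list_rev)

text \<open>In a tableau the small letters form an initial part of every row and every column.
  Stopping at the first row without small letters therefore loses nothing, and it keeps all rows
  nonempty, as \<open>is_tableau\<close> demands.\<close>

fun restrict_tableau :: "int \<Rightarrow> int list list \<Rightarrow> int list list" where
  "restrict_tableau n [] = []"
| "restrict_tableau n (r # rs) =
     (if filter (\<lambda>a. a < n) r = [] then [] else filter (\<lambda>a. a < n) r # restrict_tableau n rs)"

lemma filter_less_sorted:
  assumes "sorted_wrt (<) (r :: int list)"
  shows "filter (\<lambda>a. a < n) r = takeWhile (\<lambda>a. a < n) r"
  using assms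
proof (induction r)
  case (Cons a r)
  show ?case
  proof (cases "a < n")
    case True
    then show ?thesis using Cons by simp
  next
    case False
    then show ?thesis using Cons.prems by (auto simp: filter_empty_conv)
  qed
qed simp

lemma column_strict_filter:
  assumes "sorted_wrt (<) r" "sorted_wrt (<) s" "column_strict r s"
  shows "column_strict (filter (\<lambda>a. a < n) r) (filter (\<lambda>a. a < n) s)"
proof -
  let ?P = "\<lambda>a. a < n"
  have ls: "length (takeWhile ?P s) \<le> length s" by (rule length_takeWhile_le)
  have "length (takeWhile ?P s) \<le> length (takeWhile ?P r)"
  proof (rule length_takeWhile_less_P_nth)
    fix i assume i: "i < length (takeWhile ?P s)"
    then have "s ! i < n" using nth_length_takeWhile takeWhile_nth set_takeWhileD by (metis nth_mem)
    moreover have "r ! i < s ! i" using i ls assms(3) by (auto simp: column_strict_def)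
    ultimately show "r ! i < n" by simp
  next
    show "length (takeWhile ?P s) \<le> length r" using ls assms(3) by (auto simp: column_strict_def)
  qed
  then show ?thesis using assms ls by (auto simp: filter_less_sorted column_strict_def takeWhile_nth)
qed

lemma filter_reading_word_empty:
  assumes "is_tableau (r # rs)" "filter (\<lambda>a. a < n) r = []"
  shows "filter (\<lambda>a. a < n) (reading_word rs) = []"
  using assms
proof (induction rs arbitrary: r)
  case (Cons s ss)
  have "column_strict (filter (\<lambda>a. a < n) r) (filter (\<lambda>a. a < n) s)" using column_strict_filter[of r s n] Cons.prems by simp
  then have "filter (\<lambda>a. a < n) s = []" using Cons.prems(2) by (simp add: column_strict_def)
  then show ?case using Cons.IH[of s] Cons.prems by simp
qed auto

lemma is_tableau_restrict:
  assumes "is_tableau T"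
  shows "is_tableau (restrict_tableau n T) \<and> reading_word (restrict_tableau n T) = filter (\<lambda>a. a < n) (reading_word T)"
  using assms
proof (induction T)
  case (Cons r rs)
  show ?case
  proof (cases "filter (\<lambda>a. a < n) r = []")
    case True
    then show ?thesis using filter_reading_word_empty[OF Cons.prems True] by simp
  next
    case False
    have "column_strict (filter (\<lambda>a. a < n) r) (hd (restrict_tableau n rs))" if "restrict_tableau n rs \<noteq> []"
      using that Cons.prems column_strict_filter[of r "hd rs" n] by (cases rs) (auto split: if_splits)
    then show ?thesis using False Cons by (auto simp: sorted_wrt_filter)
  qed
qed auto

text \<open>Restriction of letters respects Knuth classes, and the restricted reading word of a
  tableau is the reading word of the restricted tableau, which inserts to itself.\<close>

lemma rs_tableau_filter_less:
  assumes "distinct w"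
  shows "rs_tableau (filter (\<lambda>a. a < n) w) = restrict_tableau n (rs_tableau w)"
proof -
  have T: "is_tableau (rs_tableau w)" using is_tableau_rs_tableau assms by blast
  have "knuth_eq (filter (\<lambda>a. a < n) w) (filter (\<lambda>a. a < n) (reading_word (rs_tableau w)))"
    by (rule knuth_eq_filter[OF knuth_eq_reading_word[OF assms]]) auto
  then have "rs_tableau (filter (\<lambda>a. a < n) w) = rs_tableau (filter (\<lambda>a. a < n) (reading_word (rs_tableau w)))"
    using knuth_eq_rs_tableau assms by simp
  then show ?thesis using is_tableau_restrict[OF T] rs_tableau_reading_word by metis
qed

section \<open>Shapes under reversal and negation\<close>

lemma length_row_insert: "length r \<le> length (fst (row_insert x r))"
  by (induction r) (auto split: prod.split)

lemma sum_take_tableau_insert: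
  "sum_list (take k (map length T)) \<le> sum_list (take k (map length (tableau_insert x T)))"
proof (induction T arbitrary: x k)
  case (Cons r rs)
  show ?case
  proof (cases k)
    case (Suc k')
    obtain r' b where rb: "row_insert x r = (r', b)" by fastforce
    then have "length r \<le> length r'" using length_row_insert[of r x] by simp
    then show ?thesis using Suc rb Cons.IH[of k'] by (auto split: option.split intro!: add_mono)
  qed simp
qed simp

lemma sum_take_insert_word:
  "sum_list (take k (map length T)) \<le> sum_list (take k (map length (insert_word T w)))"
proof (induction w arbitrary: T)
  case (Cons x w)
  show ?case using sum_take_tableau_insert[of k T x] Cons.IH[of "tableau_insert x T"] by simp
qed simp

lemma bump_append_small:
  "\<forall>c\<in>set C. \<forall>x\<in>set b. c < x \<Longrightarrow> bump (C @ B) b = bump B b"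
proof (induction b arbitrary: B)
  case (Cons x b)
  then show ?case using row_insert_append[of C x B] by simp
qed simp

text \<open>Each letter enters strictly to the right of its predecessor. The places passed are
  thereby frozen, so only original letters of \<open>r\<close> are ejected, and from left to
  right.\<close>

lemma bump_increasing:
  assumes "sorted_wrt (<) r" "sorted_wrt (<) b" "distinct (r @ b)"
  shows "sorted_wrt (<) (bump r b) \<and> set (bump r b) \<subseteq> set r"
  using assms
proof (induction b arbitrary: r)
  case (Cons x b)
  have "x \<notin> set r" using Cons.prems by simp
  with Cons.prems(1) show ?case
  proof (cases rule: row_insert_cases)
    case app
    have "bump (r @ [x]) b = bump [] b"
      using bump_append_small[of "r @ [x]" b "[]"] app Cons.prems by fastforce
    then show ?thesis using app Cons.IH[of "[]"] Cons.prems by simp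
  next
    case (bump A y B)
    have "bump ((A @ [x]) @ B) b = bump B b"
    proof (rule bump_append_small, intro ballI)
      fix c b' assume "c \<in> set (A @ [x])" "b' \<in> set b"
      then have "c \<le> x" "x < b'" using bump Cons.prems by auto
      then show "c < b'" by simp
    qed
    moreover have "sorted_wrt (<) (bump B b) \<and> set (bump B b) \<subseteq> set B"
      by (rule Cons.IH) (use bump Cons.prems in \<open>auto simp: sorted_wrt_append\<close>)
    ultimately show ?thesis using bump Cons.prems by (auto simp: sorted_wrt_append)
  qed
qed simp

text \<open>Increasing words eject increasing words, so an increasing word, possibly empty, passes
  below the last row, where it forms at most one row.\<close>

lemma length_insert_increasing:
  assumes "\<forall>r\<in>set T. sorted_wrt (<) r" "sorted_wrt (<) b" "distinct (concat T @ b)"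
  shows "length (insert_word T b) \<le> Suc (length T)"
  using assms
proof (induction T arbitrary: b)
  case Nil
  then show ?case using insert_word_row[of b "[]"] by (cases "b = []") auto
next
  case (Cons r rs)
  have "distinct (r @ b)" using Cons.prems by auto
  then have b: "sorted_wrt (<) (bump r b)" "set (bump r b) \<subseteq> set r" "distinct (bump r b)"
    using bump_increasing[of r b] distinct_bump[of r b] Cons.prems by auto
  have "length (insert_word rs (bump r b)) \<le> Suc (length rs)"
    by (rule Cons.IH) (use b Cons.prems in auto)
  then show ?case by (simp add: insert_word_Cons)
qed

lemma is_tableau_rows: "is_tableau T \<Longrightarrow> r \<in> set T \<Longrightarrow> sorted_wrt (<) r \<and> r \<noteq> []"
  by (induction T) auto

lemma length_rs_tableau_runs:
  assumes "\<forall>r\<in>set Ts. sorted_wrt (<) r" "distinct (concat Ts)"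
  shows "length (rs_tableau (concat Ts)) \<le> length Ts"
  using assms
proof (induction Ts rule: rev_induct)
  case Nil
  show ?case by (simp add: rs_tableau_def)
next
  case (snoc b Ts)
  have d: "distinct (concat Ts)" using snoc by simp
  note T = is_tableau_rs_tableau[OF d]
  have "distinct (concat (rs_tableau (concat Ts)) @ b)"
    using snoc.prems T by (metis concat.simps concat_append append_Nil2 mset_append mset_eq_imp_distinct_iff)
  then have "length (insert_word (rs_tableau (concat Ts)) b) \<le> Suc (length (rs_tableau (concat Ts)))"
    using T is_tableau_rows snoc.prems by (intro length_insert_increasing) auto
  then show ?case using snoc d by (simp add: rs_tableau_append)
qed

lemma revneg_reading_word: "revneg (reading_word T) = concat (map revneg T)"
  by (induction T) (auto simp: revneg_def)

lemma sorted_revneg: "sorted_wrt (<) r \<Longrightarrow> sorted_wrt (<) (revneg r)"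
  by (auto simp: revneg_def sorted_wrt_rev sorted_wrt_map)

lemma size_rs_tableau: "distinct w \<Longrightarrow> sum_list (map length (rs_tableau w)) = length w"
  using is_tableau_rs_tableau[of w] by (metis length_concat mset_eq_length)

lemma distinct_concat_revneg: "distinct (concat (map revneg T)) = distinct (concat T)"
  using distinct_reading_word revneg_reading_word by (metis distinct_revneg)

text \<open>
  Reversing and negating the reading word of a tableau gives a concatenation of increasing runs
  whose lengths are the row lengths. As a run creates at most one new row, the new shape dominates
  the old one.
\<close>

lemma shape_revneg_dominates:
  assumes "distinct w"
  shows "sum_list (take k (map length (rs_tableau w)))
    \<le> sum_list (take k (map length (rs_tableau (revneg w))))"
proof -
  let ?T = "rs_tableau w"
  let ?u = "concat (map revneg (take k ?T))" and ?v = "concat (map revneg (drop k ?T))"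
  have T: "is_tableau ?T" "distinct (concat ?T)"
    using is_tableau_rs_tableau[OF assms] assms by (auto dest: mset_eq_imp_distinct_iff)
  have "rs_tableau (revneg w) = rs_tableau (revneg (reading_word ?T))"
    using knuth_eq_rs_tableau[OF knuth_eq_revneg[OF knuth_eq_reading_word[OF assms]]] assms by simp
  also have "revneg (reading_word ?T) = ?u @ ?v"
    unfolding revneg_reading_word by (metis append_take_drop_id concat_append map_append)
  finally have 1: "rs_tableau (revneg w) = insert_word (rs_tableau ?u) ?v" by (simp add: rs_tableau_append)
  have d: "distinct ?u"
    using T(2) unfolding distinct_concat_revneg
    by (metis append_take_drop_id concat_append distinct_append)
  have l: "length (rs_tableau ?u) \<le> k"
  proof -
    have "length (rs_tableau ?u) \<le> length (map revneg (take k ?T))"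
      using is_tableau_rows[OF T(1)] d by (intro length_rs_tableau_runs) (auto dest!: in_set_takeD intro!: sorted_revneg)
    then show ?thesis by simp
  qed
  have "map length (map revneg (take k ?T)) = take k (map length ?T)"
    by (simp add: take_map revneg_def)
  then have "sum_list (take k (map length ?T)) = length ?u"
    unfolding length_concat by metis
  also have "\<dots> = sum_list (take k (map length (rs_tableau ?u)))"
    using size_rs_tableau[OF d] l by simp
  also have "\<dots> \<le> sum_list (take k (map length (rs_tableau (revneg w))))"
    unfolding 1 by (rule sum_take_insert_word)
  finally show ?thesis .
qed

lemma eq_if_prefix_sums_eq:
  fixes a b :: "nat list"
  assumes "0 \<notin> set a" "0 \<notin> set b" "\<And>k. sum_list (take k a) = sum_list (take k b)"
  shows "a = b"
  using assms
proof (induction a arbitrary: b)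
  case Nil
  then show ?case using Nil.prems(3)[of 1] by (cases b) auto
next
  case (Cons x a)
  obtain y b' where b: "b = y # b'" using Cons.prems(1) Cons.prems(3)[of 1] by (cases b) auto
  have "x = y" using Cons.prems(3)[of 1] b by simp
  moreover have "a = b'"
    by (rule Cons.IH) (use Cons.prems(1,2) Cons.prems(3)[of "Suc _"] b \<open>x = y\<close> in auto)
  ultimately show ?case using b by simp
qed

lemma zero_notin_shape: "distinct w \<Longrightarrow> 0 \<notin> set (map length (rs_tableau w))"
  using is_tableau_rows[of "rs_tableau w"] is_tableau_rs_tableau[of w] by auto

text \<open>As \<open>revneg\<close> is an involution, dominance holds in both directions, and equal
  prefix sums determine the shape.\<close>

lemma shape_revneg:
  assumes "distinct w"
  shows "map length (rs_tableau (revneg w)) = map length (rs_tableau w)"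
proof (rule eq_if_prefix_sums_eq)
  fix k
  show "sum_list (take k (map length (rs_tableau (revneg w)))) = sum_list (take k (map length (rs_tableau w)))"
    using shape_revneg_dominates[of w k] shape_revneg_dominates[of "revneg w" k] assms by simp
qed (use zero_notin_shape assms distinct_revneg in \<open>blast+\<close>)

section \<open>Empty 2-cores\<close>

text \<open>The number of even boxes minus the number of odd boxes; it vanishes iff the 2-core is empty.\<close>

fun balance :: "nat list \<Rightarrow> int" where
  "balance [] = 0"
| "balance (a # as) = (if odd a then 1 else 0) - balance as"

lemma restrict_tableau_id:
  "is_tableau T \<Longrightarrow> \<forall>a\<in>set (concat T). a < n \<Longrightarrow> restrict_tableau n T = T"
  by (induction T) (auto simp: filter_id_conv)

lemma restrict_tableau_Cons:
  assumes "r \<noteq> []" "\<forall>a\<in>set r. a < n"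
  shows "restrict_tableau n (r # rs) = r # restrict_tableau n rs"
  using assms by (simp add: filter_id_conv)

lemma length_filter_less_max:
  fixes n :: int
  assumes "distinct r" "n \<in> set r" "\<forall>a\<in>set r. a \<le> n"
  shows "length (filter (\<lambda>a. a < n) r) = length r - 1"
proof -
  have "filter (\<lambda>a. a < n) r = filter (\<lambda>a. n \<noteq> a) r" using assms(3) by (intro filter_cong) auto
  also have "\<dots> = remove1 n r" using assms(1) by (simp add: distinct_remove1_removeAll removeAll_filter_not_eq)
  finally show ?thesis using assms by (simp add: length_remove1)
qed

text \<open>The largest letter ends its row, so only the length of the first row changes. If that
  row is \<open>[n]\<close>, it disappears from the restriction, but then column strictness rules
  out any lower row and the formula still holds.\<close>

lemma balance_restrict_max:
  assumes "is_tableau (r # rs)" "distinct (concat (r # rs))" "\<forall>a\<in>set (concat (r # rs)). a \<le> n" "n \<in> set r"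
  shows "balance (map length (restrict_tableau n (r # rs))) =
     (if odd (length r - 1) then 1 else 0) - balance (map length rs)"
proof -
  have l: "length (filter (\<lambda>a. a < n) r) = length r - 1" using assms by (intro length_filter_less_max) auto
  have "a < n" if "a \<in> set (concat rs)" for a
  proof -
    have "a \<noteq> n" "a \<le> n" using that assms(2-4) by auto
    then show ?thesis by simp
  qed
  then have rs: "restrict_tableau n rs = rs" using assms(1) by (intro restrict_tableau_id) auto
  show ?thesis
  proof (cases "length r = 1")
    case False
    moreover have "length r \<noteq> 0" using assms(1) by simp
    ultimately have "length (filter (\<lambda>a. a < n) r) \<noteq> 0" using l by arith
    then have "filter (\<lambda>a. a < n) r \<noteq> []" by (metis list.size(3))
    then show ?thesis using rs l by simp
  next
    case True
    then have r: "r = [n]" using assms(4) by (auto simp: length_Suc_conv)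
    have "rs = []"
    proof (cases rs)
      case (Cons s ss)
      then have "n < s ! 0" "s ! 0 \<in> set s" using assms(1) r by (auto simp: column_strict_def)
      moreover have "s ! 0 \<le> n" using assms(3) Cons calculation(2) by simp
      ultimately show ?thesis by simp
    qed simp
    then show ?thesis using r by simp
  qed
qed

text \<open>
  Here \<open>h\<close> sits in column \<open>k\<close> of the first row. Inserting the rest \<open>x\<close> of that row into the rows
  below performs a jeu de taquin slide into the hole left by \<open>h\<close>. If it ends at the box of the
  maximum \<open>n\<close>, which is what equality of the shapes means, then its last step moves \<open>n\<close> to a
  neighbouring box.
\<close>

lemma balance_slide:
  assumes "is_tableau (r # rs)" "distinct (concat (r # rs))" "\<forall>a\<in>set (concat (r # rs)). a \<le> n"
    and "n \<in> set (concat (r # rs))" "n \<noteq> h" "r = take k x @ h # drop k x" "k \<le> length x"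
    and "map length (insert_word rs x) = map length (restrict_tableau n (r # rs))"
  shows "balance (map length (restrict_tableau n (insert_word rs x))) = balance (map length (r # rs))"
  using assms
proof (induction rs arbitrary: r k x h)
  case (Nil r k x h)
  have "set r = insert h (set x)" using Nil.prems(6) by (metis append_take_drop_id list.simps(15) set_append Un_insert_right)
  then have nx: "n \<in> set x" "x \<noteq> []" "\<forall>a\<in>set x. a \<le> n" using Nil.prems by auto
  have sx: "sorted_wrt (<) (take k x @ drop k x)"
    using Nil.prems(1,6) unfolding sorted_wrt_append by (auto simp: sorted_wrt_append)
  then have x: "is_tableau [x]" using nx by simp
  have "insert_word [] x = [x]" using insert_word_row[OF x] .
  then show ?case using balance_restrict_max[OF x, of n] nx Nil.prems(6,7) x by (auto simp: strict_sorted_iff)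
next
  case (Cons s ss r k x h)
  have lr: "length r = Suc (length x)" using Cons.prems(6,7) by simp
  have setr: "set r = insert h (set x)" using Cons.prems(6) by (metis append_take_drop_id list.simps(15) set_append Un_insert_right)
  have sx: "sorted_wrt (<) x"
  proof -
    have "sorted_wrt (<) (take k x @ drop k x)" using Cons.prems(1,6)
      unfolding sorted_wrt_append by (auto simp: sorted_wrt_append)
    then show ?thesis by simp
  qed
  have s: "sorted_wrt (<) s" "s \<noteq> []" "is_tableau (s # ss)" "length s \<le> Suc (length x)" "\<forall>j<length s. r ! j < s ! j"
    using Cons.prems(1) lr by (auto simp: column_strict_def)
  have dx: "distinct (concat (s # ss) @ x)" using Cons.prems(2) setr sx by (auto simp: strict_sorted_iff)
  have T': "is_tableau (insert_word (s # ss) x)"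
    "mset (concat (insert_word (s # ss) x)) = mset (concat (s # ss)) + mset x"
    using is_tableau_insert_word[OF s(3) dx] by auto
  \<comment> \<open>For a hole in column \<open>p\<close>, the right neighbour is
    \<open>x ! p\<close> and the lower one \<open>s ! p\<close>. The disjuncts say that there is no
    lower neighbour, that there is no right one, or that the lower one is smaller. At the least such
    \<open>p\<close> the hole leaves the row downwards or, without a lower neighbour, runs on to the
    end of the row.\<close>
  define P where "P p \<longleftrightarrow> k \<le> p \<and> (length s \<le> p \<or> length x \<le> p \<or> s ! p < x ! p)" for p
  define p where "p = (LEAST p. P p)"
  have Px: "P (length x)" using Cons.prems(7) by (simp add: P_def)
  have Pp: "P p" unfolding p_def using Px by (rule LeastI)
  have px: "p \<le> length x" unfolding p_def using Px by (rule Least_le)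
  have kp: "k \<le> p" using Pp P_def by simp
  have lo: "x ! i < s ! i" if "i < p" "i < length s" for i
  proof (cases "i < k")
    case True
    then have "r ! i = x ! i" using Cons.prems(6,7) by (simp add: nth_append)
    then show ?thesis using s(5) that by metis
  next
    case False
    then have "\<not> P i" using that not_less_Least unfolding p_def by blast
    then have "\<not> s ! i < x ! i" "i < length x" using False that by (auto simp: P_def)
    moreover have "s ! i \<noteq> x ! i"
    proof
      assume "s ! i = x ! i"
      then have "s ! i \<in> set s" "s ! i \<in> set x" using that \<open>i < length x\<close> by (metis nth_mem)+
      then show False using dx by auto
    qed
    ultimately show ?thesis by simp
  qed
  have hi: "x ! i < s ! Suc i" if "p \<le> i" "Suc i < length s" for i
  proof -
    have "r ! Suc i = x ! i" using Cons.prems(6,7) that kp by (simp add: nth_append Suc_diff_le)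
    then show ?thesis using s(5) that by metis
  qed
  show ?case
  proof (cases "length s \<le> p")
    case True
    \<comment> \<open>No letter of the second row rises, and the first row becomes one box shorter.
      Equality of the shapes then puts \<open>n\<close> into the first row as well, so the two
      deleted boxes form a horizontal domino.\<close>
    have "feed ([] @ s @ []) x = [] @ x @ [] \<and> bump ([] @ s @ []) x = s"
      by (rule feed_segment) (use True lo px sx in auto)
    then have T'_eq: "insert_word (s # ss) x = x # s # ss"
      using insert_word_row[OF s(3)] by (simp add: insert_word_Cons)
    have "n \<in> set r"
    proof (rule ccontr)
      assume "n \<notin> set r"
      then have "\<forall>a\<in>set r. a < n" using Cons.prems(3) by (metis UnI1 concat.simps(2) order_le_less set_append)
      then have "restrict_tableau n (r # s # ss) = r # restrict_tableau n (s # ss)"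
        using Cons.prems(1) by (intro restrict_tableau_Cons) auto
      then show False using Cons.prems(8) T'_eq lr by simp
    qed
    then have nx: "n \<in> set x" using setr Cons.prems(5) by auto
    have "balance (map length (restrict_tableau n (x # s # ss))) =
        (if odd (length x - 1) then 1 else 0) - balance (map length (s # ss))"
      by (rule balance_restrict_max) (use T'(1) dx Cons.prems(3) nx setr T'_eq in auto)
    moreover have "length x > 0" using nx by (cases x) auto
    ultimately show ?thesis using T'_eq lr by simp
  next
    case False
    then have ps: "p < length s" by simp
    \<comment> \<open>The letter \<open>s ! p\<close> rises between \<open>?a\<close> and
      \<open>?b\<close>, which leaves a hole in column \<open>p\<close> of the second row.\<close>
    let ?a = "take p x" and ?b = "drop p x" and ?s = "take p s @ drop (Suc p) s"
    have sxp: "sorted_wrt (<) (?a @ s ! p # ?b)"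
    proof -
      have "\<forall>a\<in>set ?a. a < s ! p"
      proof
        fix a assume "a \<in> set ?a"
        then obtain i where i: "i < p" "a = x ! i" using px by (auto simp: in_set_conv_nth)
        then have "x ! i < s ! i" "s ! i < s ! p" using lo ps s(1) by (auto intro: sorted_wrt_nth_less)
        then show "a < s ! p" using i by simp
      qed
      moreover have "\<forall>b\<in>set ?b. s ! p < b"
      proof
        fix b assume "b \<in> set ?b"
        then obtain i where "i < length ?b" "b = ?b ! i" by (metis in_set_conv_nth)
        then have i: "p + i < length x" "b = x ! (p + i)" by simp_all
        then have "s ! p < x ! p" using Pp ps by (auto simp: P_def)
        moreover have "x ! p \<le> x ! (p + i)" using i sorted_wrt_nth_less[OF sx, of p "p + i"] by (cases "i = 0") auto
        ultimately show "s ! p < b" using i by simp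
      qed
      moreover have "sorted_wrt (<) (?a @ ?b)" using sx by simp
      ultimately show ?thesis unfolding sorted_wrt_append by (auto intro: less_trans)
    qed
    have f1: "feed ([] @ take p s @ drop p s) ?a = [] @ ?a @ drop p s \<and> bump ([] @ take p s @ drop p s) ?a = take p s"
      by (rule feed_segment) (use lo ps px sx in \<open>auto simp: sorted_wrt_take\<close>)
    have f2: "feed ((?a @ [s ! p]) @ drop (Suc p) s @ []) ?b = (?a @ [s ! p]) @ ?b @ []
       \<and> bump ((?a @ [s ! p]) @ drop (Suc p) s @ []) ?b = drop (Suc p) s"
    proof (rule feed_segment)
      show "\<forall>j<length (drop (Suc p) s). ?b ! j < drop (Suc p) s ! j"
        using hi px ps s(4) by auto
      show "length (drop (Suc p) s) = length ?b \<or> length (drop (Suc p) s) < length ?b \<and> ([] :: int list) = []"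
        using s(4) px by auto
    qed (use sxp in simp)
    have ds: "drop p s = s ! p # drop (Suc p) s" using ps by (simp add: Cons_nth_drop_Suc)
    have fb: "feed s x = ?a @ s ! p # ?b" "bump s x = ?s"
  proof -
      have "feed s ?a = ?a @ drop p s" "bump s ?a = take p s" using f1 by simp_all
      then show "feed s x = ?a @ s ! p # ?b" "bump s x = ?s"
        using f2 ds feed_append[of s ?a ?b] bump_append[of s ?a ?b] by simp_all
    qed
    let ?T1 = "insert_word ss ?s"
    have T'_eq: "insert_word (s # ss) x = (?a @ s ! p # ?b) # ?T1" by (simp add: insert_word_Cons fb)
    have lx: "length (?a @ s ! p # ?b) = length r" using lr px by simp
    \<comment> \<open>The first row keeps its length under the slide, while deleting
      \<open>n\<close> from it would shorten it.\<close>
    have nr: "n \<notin> set r"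
    proof
      assume nr: "n \<in> set r"
      then have "length (filter (\<lambda>a. a < n) r) = length r - 1" using Cons.prems by (intro length_filter_less_max) auto
      then show False using Cons.prems(8) lx lr unfolding T'_eq by (auto split: if_splits)
    qed
    then have rn: "\<forall>a\<in>set r. a < n" using Cons.prems(3) by (metis UnI1 concat.simps(2) order_le_less set_append)
    then have "restrict_tableau n (r # s # ss) = r # restrict_tableau n (s # ss)"
      using Cons.prems(1) by (intro restrict_tableau_Cons) auto
    then have shp: "map length ?T1 = map length (restrict_tableau n (s # ss))"
      using Cons.prems(8) T'_eq by simp
    have pr: "distinct (concat (s # ss))" "\<forall>a\<in>set (concat (s # ss)). a \<le> n" "n \<in> set (concat (s # ss))"
      using Cons.prems nr by auto
    show ?thesis
    proof (cases "s ! p = n")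
      case False
      have "balance (map length (restrict_tableau n ?T1)) = balance (map length (s # ss))"
        by (rule Cons.IH[OF s(3) pr, of "s ! p" p])
          (use False shp ps in \<open>auto simp: min_def id_take_nth_drop[symmetric]\<close>)
      moreover have "s ! p < n" using False pr(2) ps by (simp add: order_less_le)
      then have "\<forall>a\<in>set (?a @ s ! p # ?b). a < n"
        using rn setr by (auto dest!: in_set_takeD in_set_dropD)
      then have "restrict_tableau n (insert_word (s # ss) x) = (?a @ s ! p # ?b) # restrict_tableau n ?T1"
        unfolding T'_eq by (intro restrict_tableau_Cons) auto
      ultimately show ?thesis using lx by simp
    next
      case True
      \<comment> \<open>The rising letter is \<open>n\<close> itself, so nothing stands to its
        right. The first two rows then both end in column \<open>p\<close>, and their last boxes,
        which are the deleted ones, form a vertical domino.\<close>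
      have "?b = []"
      proof (rule ccontr)
        assume "?b \<noteq> []"
        then have "hd ?b \<in> set ?b" by simp
        then have "n < hd ?b" "hd ?b \<in> set x" using sxp True by (auto simp: sorted_wrt_append dest: in_set_dropD)
        then show False using rn setr by force
      qed
      then have "length x = p" "length s = Suc p" using px ps s(4) by auto
      have ns: "n \<in> set s" using True ps by force
      have "balance (map length (restrict_tableau n (s # ss))) =
          (if odd (length s - 1) then 1 else 0) - balance (map length ss)"
        by (rule balance_restrict_max[OF s(3) pr(1,2) ns])
      moreover have "balance (map length (restrict_tableau n (insert_word (s # ss) x))) =
          (if odd (length (?a @ s ! p # ?b) - 1) then 1 else 0) - balance (map length ?T1)"
        unfolding T'_eq
      proof (rule balance_restrict_max)
        show "is_tableau ((?a @ s ! p # ?b) # ?T1)" using T'(1) T'_eq by simp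
        show "distinct (concat ((?a @ s ! p # ?b) # ?T1))"
          using T'(2) dx unfolding T'_eq by (metis mset_append mset_eq_imp_distinct_iff)
        have "set (concat ((?a @ s ! p # ?b) # ?T1)) = set (concat (s # ss)) \<union> set x"
          using T'(2) unfolding T'_eq by (metis mset_append set_append set_mset_mset)
        then show "\<forall>a\<in>set (concat ((?a @ s ! p # ?b) # ?T1)). a \<le> n" using pr(2) rn setr by force
      qed (use True in simp)
      ultimately show ?thesis using shp lx lr \<open>length x = p\<close> \<open>length s = Suc p\<close> by simp
    qed
  qed
qed

lemma is_tableau_hd_le:
  "is_tableau (r # rs) \<Longrightarrow> a \<in> set (concat (r # rs)) \<Longrightarrow> hd r \<le> a"
proof (induction rs arbitrary: r)
  case Nil
  then show ?case by (cases r) auto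
next
  case (Cons s ss)
  have "hd r \<le> b" if "b \<in> set r" for b using Cons.prems that by (cases r) auto
  moreover have "hd r < hd s" using Cons.prems by (auto simp: column_strict_def hd_conv_nth)
  moreover have "hd s \<le> a" if "a \<in> set (concat (s # ss))" using Cons that by simp
  ultimately show ?case using Cons.prems(2) by force
qed

lemma filter_revneg: "filter Q (revneg w) = revneg (filter (\<lambda>a. Q (- a)) w)"
  by (induction w) (auto simp: revneg_def)

text \<open>Removing both \<open>n\<close> and \<open>- n\<close> keeps the word symmetric, and the
  absence of 0 makes these letters distinct. The two words lacking just one of them are exchanged by
  \<open>revneg\<close>, hence have the same shape; this is the hypothesis on shapes in
  \<open>balance_slide\<close>.\<close>

lemma balance_symmetric:
  assumes "distinct w" "revneg w = w" "0 \<notin> set w"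
  shows "balance (map length (rs_tableau w)) = 0"
  using assms
proof (induction "length w" arbitrary: w rule: less_induct)
  case less
  show ?case
  proof (cases "w = []")
    case True
    then show ?thesis by (simp add: rs_tableau_def)
  next
    case False
    have neg: "- a \<in> set w" if "a \<in> set w" for a
      using that less.prems(2) by (metis image_eqI revneg_def set_map set_rev)
    define n where "n = Max (set w)"
    have n: "n \<in> set w" "\<forall>a\<in>set w. a \<le> n" using False by (auto simp: n_def)
    have "- n \<le> n" "n \<noteq> 0" using neg[OF n(1)] n less.prems(3) by metis+
    then have "n > 0" by simp
    have low: "- n \<le> a" if "a \<in> set w" for a using n(2) neg[OF that] by force
    obtain r rs where T: "rs_tableau w = r # rs" using rs_tableau_rec[OF False] by simp
    have tab: "is_tableau (r # rs)" "mset (concat (r # rs)) = mset w"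
      using is_tableau_rs_tableau[OF less.prems(1)] T by auto
    have setw: "set (concat (r # rs)) = set w" using tab(2) by (metis set_mset_mset)
    have dist: "distinct (concat (r # rs))" using tab(2) less.prems(1) by (metis mset_eq_imp_distinct_iff)
    have "hd r = - n"
    proof (rule antisym)
      show "hd r \<le> - n" using is_tableau_hd_le[OF tab(1)] setw neg[OF n(1)] by blast
      have "hd r \<in> set (concat (r # rs))" using tab(1) by simp
      then show "- n \<le> hd r" using low setw by blast
    qed
    then obtain x where r: "r = - n # x" using tab(1) by (cases r) auto
    let ?w1 = "filter (\<lambda>a. - n < a) w" and ?w2 = "filter (\<lambda>a. a < n) w"
    let ?w3 = "filter (\<lambda>a. a < n) ?w1"
    have "knuth_eq ?w1 (filter (\<lambda>a. - n < a) (reading_word (rs_tableau w)))"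
      by (rule knuth_eq_filter[OF knuth_eq_reading_word[OF less.prems(1)]]) auto
    moreover have "filter (\<lambda>a. - n < a) (reading_word (rs_tableau w)) = reading_word rs @ x"
    proof -
      have "\<forall>a\<in>set (reading_word rs @ x). - n < a"
        using low dist setw unfolding r by (auto simp: less_le)
      then show ?thesis by (simp add: T r filter_id_conv)
    qed
    ultimately have T1: "rs_tableau ?w1 = insert_word rs x"
      using knuth_eq_rs_tableau[of ?w1] less.prems(1) rs_tableau_reading_word[of rs] tab(1)
      by (simp add: rs_tableau_append)
    have T2: "rs_tableau ?w2 = restrict_tableau n (r # rs)"
      using rs_tableau_filter_less[OF less.prems(1)] T by simp
    have T3: "rs_tableau ?w3 = restrict_tableau n (insert_word rs x)"
      using rs_tableau_filter_less[of ?w1] less.prems(1) T1 by simp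
    have w12: "?w1 = revneg ?w2"
      using filter_revneg[of "\<lambda>a. - n < a" w] less.prems(2) by simp
    have "map length (insert_word rs x) = map length (restrict_tableau n (r # rs))"
      using shape_revneg[of ?w2] less.prems(1) w12 T1 T2 by simp
    \<comment> \<open>The smallest letter \<open>- n\<close> occupies the corner, so the hole starts
      in column 0 of the first row.\<close>
    then have "balance (map length (restrict_tableau n (insert_word rs x))) = balance (map length (r # rs))"
      by (intro balance_slide[OF tab(1) dist, of n "- n" 0 x]) (use setw n r \<open>n > 0\<close> in simp_all)
    moreover have "balance (map length (rs_tableau ?w3)) = 0"
    proof (rule less.hyps)
      show "length ?w3 < length w"
        using n(1) length_filter_less[of n w "\<lambda>a. - n < a \<and> a < n"] by simp
      show "revneg ?w3 = ?w3"
      proof -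
        have "(\<lambda>a. - n < - a \<and> - a < n) = (\<lambda>a. - n < a \<and> a < n)" by auto
        then show ?thesis using filter_revneg[of "\<lambda>a. - n < a \<and> a < n" w] less.prems(2) by simp
      qed
    qed (use less.prems in auto)
    ultimately show ?thesis using T T3 by simp
  qed
qed

section \<open>Application to signed permutations\<close>

lemma minus_word_symmetric:
  assumes "signed_perm n w"
  shows "distinct (minus_word n w)" "revneg (minus_word n w) = minus_word n w" "0 \<notin> set (minus_word n w)"
proof -
  let ?I = "{- int n..int n} - {0}"
  have b: "bij_betw w ?I ?I" and neg: "\<And>i. i \<in> ?I \<Longrightarrow> w (- i) = - w i"
    using assms by (auto simp: signed_perm_def)
  have mw: "minus_word n w = map w (map uminus (rev [1..int n]) @ [1..int n])"
    using neg by (auto simp: minus_word_def)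
  have st: "set (map uminus (rev [1..int n]) @ [1..int n]) = ?I"
  proof -
    have "uminus ` {1..int n} = {- int n.. -1}" by simp
    then show ?thesis by auto
  qed
  have "distinct (map uminus (rev [1..int n]) @ [1..int n])"
    by (auto simp: distinct_map)
  then show "distinct (minus_word n w)"
    unfolding mw distinct_map st using b by (simp add: bij_betw_def)
  have "set (minus_word n w) = ?I"
    unfolding mw set_map st using b by (rule bij_betw_imp_surj_on)
  then show "0 \<notin> set (minus_word n w)" by blast
  show "revneg (minus_word n w) = minus_word n w"
    by (simp add: minus_word_def revneg_def rev_map o_def)
qed

lemma domino_type_balance:
  assumes "domino_type n p"
  shows "balance p = 0"
proof -
  obtain w where "signed_perm n w" "p = shape (rs_tableau (minus_word n w))"
    using assms by (auto simp: domino_type_def)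
  then show ?thesis using balance_symmetric[OF minus_word_symmetric] by (simp add: shape_def)
qed

section \<open>Beta numbers and symbols\<close>

lemma part_antimono:
  assumes "is_partition p" "1 \<le> i" "i \<le> j"
  shows "part p j \<le> part p i"
  using assms sorted_wrt_nth_less[of "(\<ge>)" p "i - 1" "j - 1"]
  by (cases "i = j") (auto simp: part_def is_partition_def)

lemma part_eq_0_iff: "is_partition p \<Longrightarrow> 1 \<le> k \<Longrightarrow> part p k = 0 \<longleftrightarrow> length p < k"
proof -
  assume p: "is_partition p" "1 \<le> k"
  have "p ! (k - 1) \<noteq> 0" if "k \<le> length p"
  proof -
    have "k - 1 < length p" using p that by simp
    then have "p ! (k - 1) \<in> set p" by simp
    then show ?thesis using p(1) unfolding is_partition_def by metis
  qed
  then show ?thesis using p by (auto simp: part_def)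
qed

lemma partition_eqI:
  assumes "is_partition p" "is_partition q" "\<And>k. 1 \<le> k \<Longrightarrow> part p k = part q k"
  shows "p = q"
proof (rule nth_equalityI)
  show l: "length p = length q"
  proof (rule ccontr)
    assume "length p \<noteq> length q"
    then have "length p < max (length p) (length q) \<and> \<not> length q < max (length p) (length q) \<or>
      length q < max (length p) (length q) \<and> \<not> length p < max (length p) (length q)" by auto
    moreover have "1 \<le> max (length p) (length q)" using \<open>length p \<noteq> length q\<close> by (cases p; cases q) auto
    ultimately show False using assms part_eq_0_iff by metis
  qed
  fix i assume "i < length p"
  then show "p ! i = q ! i" using assms(3)[of "Suc i"] l by (simp add: part_def)
qed

lemma ex_partition_of_antimono:
  fixes g :: "nat \<Rightarrow> nat"
  assumes "\<And>i. 1 \<le> i \<Longrightarrow> g (Suc i) \<le> g i" "\<And>i. N < i \<Longrightarrow> g i = 0"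
  shows "\<exists>q. is_partition q \<and> length q \<le> N \<and> (\<forall>k \<ge> 1. part q k = g k)"
  using assms
proof (induction N arbitrary: g)
  case 0
  then show ?case by (intro exI[of _ "[]"]) (auto simp: is_partition_def part_def)
next
  case (Suc N)
  have "\<exists>q. is_partition q \<and> length q \<le> N \<and> (\<forall>k \<ge> 1. part q k = g (Suc k))"
    by (rule Suc.IH) (use Suc.prems in auto)
  then obtain q where q: "is_partition q" "length q \<le> N" "\<And>k. k \<ge> 1 \<Longrightarrow> part q k = g (Suc k)" by blast
  have mono: "g i \<le> g 1" if "1 \<le> i" for i
    using that by (induction i rule: dec_induct) (use Suc.prems(1) order_trans in auto)
  show ?case
  proof (cases "g 1 = 0")
    case True
    then have "\<forall>k\<ge>1. part [] k = g k" using mono by (auto simp: part_def)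
    then show ?thesis by (intro exI[of _ "[]"]) (auto simp: is_partition_def)
  next
    case False
    have pt: "part (g 1 # q) k = g k" if "1 \<le> k" for k
    proof (cases "k = 1")
      case True
      then show ?thesis by (simp add: part_def)
    next
      case False
      then obtain j where j: "k = Suc j" "1 \<le> j" using \<open>1 \<le> k\<close> by (cases k) auto
      then have "part (g 1 # q) k = part q j" by (auto simp: part_def nth_Cons')
      then show ?thesis using q(3)[OF j(2)] j(1) by simp
    qed
    have "x \<le> g 1" if "x \<in> set q" for x
    proof -
      obtain i where "i < length q" "x = q ! i" using \<open>x \<in> set q\<close> by (metis in_set_conv_nth)
      then have "x = g (Suc (Suc i))" using q(3)[of "Suc i"] by (simp add: part_def)
      then show ?thesis using mono by simp
    qed
    then have "is_partition (g 1 # q)" using q False by (auto simp: is_partition_def)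
    then show ?thesis using q pt by (intro exI[of _ "g 1 # q"]) auto
  qed
qed

lemma sum_list_part:
  assumes "length q \<le> K"
  shows "sum_list q = (\<Sum>k=1..K. part q k)"
proof -
  have "sum_list q = (\<Sum>i<length q. q ! i)" by (simp add: sum_list_sum_nth atLeast0LessThan)
  also have "\<dots> = (\<Sum>i<length q. part q (Suc i))" by (simp add: part_def)
  also have "\<dots> = (\<Sum>i<K. part q (Suc i))"
    by (rule sum.mono_neutral_left) (use assms in \<open>auto simp: part_def\<close>)
  also have "\<dots> = (\<Sum>k=1..K. part q k)"
    by (simp add: sum.atLeast1_atMost_eq)
  finally show ?thesis .
qed

section \<open>Beta numbers and their parities\<close>

definition beta :: "nat \<Rightarrow> nat list \<Rightarrow> nat \<Rightarrow> nat" where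
  "beta K p k = part p k + K - k"

lemma beta_numbers_alt: "beta_numbers K p = image_mset (beta K p) (mset_set {1..K})"
  unfolding beta_numbers_def by (rule image_mset_cong) (simp add: beta_def)

lemma beta_gap:
  assumes "is_partition p" "1 \<le> i" "i \<le> j" "j \<le> K"
  shows "beta K p j + (j - i) \<le> beta K p i"
  using part_antimono[OF assms(1-3)] assms by (simp add: beta_def)

lemma inj_on_beta:
  assumes "is_partition p"
  shows "inj_on (beta K p) {1..K}"
proof (rule linorder_inj_onI)
  fix i j assume "i < j" "i \<in> {1..K}" "j \<in> {1..K}"
  then show "beta K p i \<noteq> beta K p j" using beta_gap[OF assms, of i j K] by simp
qed auto

lemma beta_numbers_inject:
  assumes "is_partition p" "is_partition q" "length p \<le> K" "length q \<le> K"
    and "beta_numbers K p = beta_numbers K q"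
  shows "p = q"
proof -
  let ?l = "\<lambda>p. map (beta K p) (rev [1..<Suc K])"
  have m: "mset (?l p) = beta_numbers K p" for p
  proof -
    have "mset (rev [1..<Suc K]) = mset_set {1..K}"
      by (simp only: mset_rev mset_upt atLeastLessThanSuc_atLeastAtMost)
    then show ?thesis unfolding beta_numbers_alt mset_map by simp
  qed
  have s: "sorted (?l p)" if "is_partition p" for p
  proof -
    have "sorted_wrt (\<lambda>i j. beta K p j \<le> beta K p i) [1..<Suc K]"
    proof (rule sorted_wrt_mono_rel[OF _ sorted_wrt_upt])
      fix i j assume "i \<in> set [1..<Suc K]" "j \<in> set [1..<Suc K]" "i < j"
      then have "1 \<le> i" "i \<le> j" "j \<le> K" by (simp_all del: upt_Suc)
      then show "beta K p j \<le> beta K p i" using beta_gap[OF that, of i j K] by linarith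
    qed
    then show ?thesis by (simp add: sorted_wrt_map sorted_wrt_rev del: upt_Suc)
  qed
  have "?l p = ?l q"
    using m s assms by (metis properties_for_sort)
  then have eq: "beta K p k = beta K q k" if "k \<in> {1..K}" for k
    using that by (simp add: map_eq_conv del: upt_Suc)
  show ?thesis
  proof (rule partition_eqI[OF assms(1,2)])
    fix k :: nat assume "1 \<le> k"
    then show "part p k = part q k"
      using eq[of k] assms(3,4) by (cases "k \<le> K") (auto simp: beta_def part_def)
  qed
qed

text \<open>Two further zero parts contribute 1 and 0 and raise all other numbers by 2, which is the
  effect of one \<open>shift\<close> on doubled entries.\<close>

lemma beta_numbers_add2:
  assumes "length q \<le> K"
  shows "beta_numbers (K + 2) q = {#0, 1#} + image_mset (\<lambda>x. x + 2) (beta_numbers K q)"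
proof -
  have "{1..K + 2} = insert (K + 1) (insert (K + 2) {1..K})" by auto
  then have "mset_set {1..K + 2} = {#K + 1, K + 2#} + mset_set {1..K}" by simp
  moreover have "part q (K + 1) = 0" "part q (K + 2) = 0" using assms by (auto simp: part_def)
  moreover have "image_mset (\<lambda>k. part q k + (K + 2) - k) (mset_set {1..K}) =
     image_mset (\<lambda>k. part q k + K - k + 2) (mset_set {1..K})"
    by (rule image_mset_cong) auto
  ultimately show ?thesis by (simp add: beta_numbers_def multiset.map_comp o_def)
qed

lemma size_beta_numbers: "size (beta_numbers K q) = K"
  by (simp add: beta_numbers_def)

text \<open>The top row contributes 1 or -1 according to the parity of its length, and moving the
  other rows down by one changes all their signs, in accordance with the recursion of
  \<open>balance\<close>. The alternating signs of zero rows leave the correction for odd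
  \<open>K\<close>.\<close>

lemma sum_sign_part:
  assumes "length q \<le> K"
  shows "(\<Sum>k=1..K. if even (part q k + k) then 1 else -1 :: int) = 2 * balance q - (if odd K then 1 else 0)"
  using assms
proof (induction q arbitrary: K)
  case Nil
  have "(\<Sum>k=1..K. if even k then 1 else -1 :: int) = - (if odd K then 1 else 0)"
    by (induction K) auto
  then show ?case by (simp add: part_def)
next
  case (Cons a q)
  then obtain K' where K: "K = Suc K'" "length q \<le> K'" by (cases K) auto
  have shift1: "(\<Sum>k=1..Suc K'. f k) = f 1 + (\<Sum>k=1..K'. f (Suc k))" for f :: "nat \<Rightarrow> int"
    by (induction K') auto
  have "(\<Sum>k=1..K. if even (part (a # q) k + k) then 1 else -1 :: int) =
     (if odd a then 1 else -1) + (\<Sum>k=1..K'. if even (part (a # q) (Suc k) + Suc k) then 1 else -1)"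
    unfolding K(1) shift1 by (simp add: part_def)
  also have "(\<Sum>k=1..K'. if even (part (a # q) (Suc k) + Suc k) then 1 else -1 :: int) =
      - (\<Sum>k=1..K'. if even (part q k + k) then 1 else -1)"
    unfolding sum_negf[symmetric] by (rule sum.cong) (auto simp: part_def nth_Cons')
  finally show ?case using Cons.IH[OF K(2)] K(1) by simp
qed

definition sign_sum :: "nat multiset \<Rightarrow> int" where
  "sign_sum M = (\<Sum>x\<in>#M. if even x then 1 else - 1)"

text \<open>For odd \<open>K\<close> the number with index \<open>k\<close> has the parity opposite
  to \<open>part q k + k\<close>. Balance 0 thus means one more even than odd beta number.\<close>

lemma sign_sum_beta_numbers:
  assumes "length q \<le> K" "odd K"
  shows "sign_sum (beta_numbers K q) = 1 - 2 * balance q"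
proof -
  have "sign_sum (beta_numbers K q) = (\<Sum>k=1..K. if even (part q k + K - k) then 1 else - 1)"
    unfolding sign_sum_def beta_numbers_def multiset.map_comp o_def sum_unfold_sum_mset ..
  also have "\<dots> = (\<Sum>k=1..K. - (if even (part q k + k) then 1 else - 1))"
    by (rule sum.cong) (use assms(2) in auto)
  also have "\<dots> = 1 - 2 * balance q" using sum_sign_part[OF assms(1)] assms(2) by (simp add: sum_negf)
  finally show ?thesis .
qed

lemma entries_doubled: "entries A = image_mset (\<lambda>x. x div 2) (doubled_entries A)"
  by (simp add: entries_def doubled_entries_def multiset.map_comp o_def)

lemma size_doubled_entries: "A \<in> barrays \<Longrightarrow> size (doubled_entries A) = 2 * length (snd A) + 1"
  by (auto simp: barrays_def doubled_entries_def)

lemma size_entries: "A \<in> barrays \<Longrightarrow> size (entries A) = 2 * length (snd A) + 1"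
  by (auto simp: barrays_def entries_def)

lemma sign_sum_doubled_entries:
  assumes "A \<in> barrays"
  shows "sign_sum (doubled_entries A) = 1"
proof -
  have "sign_sum (doubled_entries A) = (\<Sum>x\<in>#mset (fst A). 1) + (\<Sum>x\<in>#mset (snd A). - 1)"
    by (simp add: sign_sum_def doubled_entries_def multiset.map_comp o_def)
  then show ?thesis using assms by (auto simp: barrays_def)
qed

lemma sum_doubled_entries:
  "\<Sum>\<^sub># (doubled_entries A) = 2 * \<Sum>\<^sub># (entries A) + length (snd A)"
proof -
  have "(\<Sum>x\<in>#M. 2 * x + 1) = 2 * \<Sum>\<^sub># M + size M" "(\<Sum>x\<in>#M. 2 * x) = 2 * \<Sum>\<^sub># M" for M :: "nat multiset"
    by (induction M) auto
  then show ?thesis by (simp add: doubled_entries_def entries_def)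
qed

lemma doubled_entries_inject:
  assumes "A \<in> barrays" "B \<in> barrays" "doubled_entries A = doubled_entries B"
  shows "A = B"
proof -
  have 1: "set (fst A) = {x. 2 * x \<in># doubled_entries A}" "set (snd A) = {x. 2 * x + 1 \<in># doubled_entries A}" for A
    by (auto simp: doubled_entries_def) presburger+
  have "set (fst A) = set (fst B)" "set (snd A) = set (snd B)" unfolding 1 assms(3) by auto
  then have "fst A = fst B" "snd A = snd B"
    using assms(1,2) strict_sorted_equal by (auto simp: barrays_def)
  then show ?thesis by (rule prod_eqI)
qed

text \<open>Halving is injective on numbers of equal parity, and sign sum 1 gives the two rows the
  lengths required of an array.\<close>

lemma ex_barray:
  assumes "finite X" "sign_sum (mset_set X) = 1"
  shows "\<exists>A \<in> barrays. doubled_entries A = mset_set X"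
proof -
  let ?E = "{x \<in> X. even x}" and ?O = "{x \<in> X. odd x}"
  have X: "X = ?E \<union> ?O" by auto
  have m: "mset_set X = mset_set ?E + mset_set ?O"
  proof -
    have "mset_set (?E \<union> ?O) = mset_set ?E + mset_set ?O"
      by (rule mset_set_Union) (use assms in auto)
    then show ?thesis unfolding X[symmetric] .
  qed
  have "sign_sum (mset_set X) = (\<Sum>x\<in>#mset_set ?E. 1) + (\<Sum>x\<in>#mset_set ?O. - 1)"
    unfolding m sign_sum_def image_mset_union sum_mset.union
  proof (rule arg_cong2[where f = "(+)"])
    show "(\<Sum>x\<in>#mset_set ?E. if even x then 1 else - 1 :: int) = (\<Sum>x\<in>#mset_set ?E. 1)"
      by (rule arg_cong[where f = sum_mset], rule image_mset_cong) (use assms(1) in simp)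
    show "(\<Sum>x\<in>#mset_set ?O. if even x then 1 else - 1 :: int) = (\<Sum>x\<in>#mset_set ?O. - 1)"
      by (rule arg_cong[where f = sum_mset], rule image_mset_cong) (use assms(1) in simp)
  qed
  then have c: "card ?E = Suc (card ?O)" using assms by simp
  have i: "inj_on (\<lambda>x. x div 2) ?E" "inj_on (\<lambda>x. x div 2) ?O"
  proof -
    have "x = y" if "even x \<and> even y \<or> odd x \<and> odd y" "x div 2 = y div 2" for x y :: nat
      using that by presburger
    then show "inj_on (\<lambda>x. x div 2) ?E" "inj_on (\<lambda>x. x div 2) ?O"
      unfolding inj_on_def by blast+
  qed
  let ?l = "sorted_list_of_set ((\<lambda>x. x div 2) ` ?E)" and ?m = "sorted_list_of_set ((\<lambda>x. x div 2) ` ?O)"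
  have "mset ?l = image_mset (\<lambda>x. x div 2) (mset_set ?E)" "mset ?m = image_mset (\<lambda>x. x div 2) (mset_set ?O)"
  proof -
    have ml: "mset (sorted_list_of_set F) = mset_set F" for F :: "nat set"
      using mset_sorted_list_of_multiset[of "mset_set F"] by (simp only: sorted_list_of_mset_set)
    show "mset ?l = image_mset (\<lambda>x. x div 2) (mset_set ?E)" "mset ?m = image_mset (\<lambda>x. x div 2) (mset_set ?O)"
      by (simp_all only: ml image_mset_mset_set[OF i(1)] image_mset_mset_set[OF i(2)])
  qed
  then have "doubled_entries (?l, ?m) = image_mset (\<lambda>x. 2 * (x div 2)) (mset_set ?E) + image_mset (\<lambda>x. 2 * (x div 2) + 1) (mset_set ?O)"
    by (simp add: doubled_entries_def multiset.map_comp o_def)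
  also have "\<dots> = image_mset id (mset_set ?E) + image_mset id (mset_set ?O)"
    by (rule arg_cong2[where f = "(+)"]; rule image_mset_cong) (use assms(1) in simp_all)
  also have "\<dots> = mset_set X" using m by simp
  finally have "doubled_entries (?l, ?m) = mset_set X" .
  moreover have "(?l, ?m) \<in> barrays"
    using assms(1) c i by (auto simp: barrays_def card_image)
  ultimately show ?thesis by blast
qed

lemma ex_barray_beta_numbers:
  assumes "is_partition q" "balance q = 0" "length q \<le> K" "odd K"
  shows "\<exists>A \<in> barrays. doubled_entries A = beta_numbers K q"
proof -
  have "beta_numbers K q = mset_set (beta K q ` {1..K})"
    unfolding beta_numbers_alt by (rule image_mset_mset_set[OF inj_on_beta[OF assms(1)]])
  then show ?thesis using ex_barray[of "beta K q ` {1..K}"] sign_sum_beta_numbers[OF assms(3,4)] assms(2) by simp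
qed

section \<open>Shifts, special arrays and uniqueness\<close>

lemma shift_barrays: "A \<in> barrays \<Longrightarrow> shift A \<in> barrays"
  by (cases A) (auto simp: barrays_def sorted_wrt_map)

lemma funpow_shift_barrays: "A \<in> barrays \<Longrightarrow> (shift ^^ i) A \<in> barrays"
  by (induction i) (auto simp: shift_barrays)

lemma length_snd_funpow_shift: "length (snd ((shift ^^ i) A)) = length (snd A) + i"
proof -
  have "length (snd (shift B)) = Suc (length (snd B))" for B by (cases B) simp
  then show ?thesis by (induction i) auto
qed

lemma inj_shift: "inj shift"
proof (rule injI)
  fix A B assume "shift A = shift B"
  then show "A = B" by (cases A; cases B) (auto simp: inj_map_eq_map)
qed

lemma doubled_entries_funpow_shift:
  assumes "doubled_entries A = beta_numbers K q" "length q \<le> K"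
  shows "doubled_entries ((shift ^^ i) A) = beta_numbers (K + 2 * i) q"
proof (induction i)
  case (Suc i)
  have "doubled_entries (shift B) = {#0, 1#} + image_mset (\<lambda>x. x + 2) (doubled_entries B)" for B
    by (cases B) (simp add: doubled_entries_def multiset.map_comp o_def add.commute)
  then have "doubled_entries ((shift ^^ Suc i) A) = {#0, 1#} + image_mset (\<lambda>x. x + 2) (beta_numbers (K + 2 * i) q)"
    using Suc by simp
  also have "\<dots> = beta_numbers (K + 2 * i + 2) q" using assms(2) beta_numbers_add2[of q "K + 2 * i"] by simp
  finally show ?case by simp
qed (use assms in simp)

lemma entries_funpow_shift:
  "entries B = entries A \<Longrightarrow> entries ((shift ^^ i) B) = entries ((shift ^^ i) A)"
proof (induction i)
  case (Suc i)
  have "entries (shift B) = {#0, 0#} + image_mset Suc (entries B)" for B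
    by (cases B) (simp add: entries_def)
  then show ?case using Suc by simp
qed simp

lemma special_funpow_shift:
  "B \<in> barrays \<Longrightarrow> special_array B \<Longrightarrow> special_array ((shift ^^ i) B)"
proof (induction i)
  case (Suc i)
  have "special_array (shift B)" if "B \<in> barrays" "special_array B" for B
    using that by (cases B) (auto simp: special_array_def barrays_def nth_Cons split: nat.split)
  then show ?case using Suc funpow_shift_barrays by simp
qed simp

lemma B_symbols_memD:
  assumes "L \<in> B_symbols" "A \<in> L"
  shows "A \<in> barrays" "(shift ^^ i) A \<in> L"
proof -
  obtain X where X: "X \<in> barrays" "L = shift_equiv `` {X}" using assms(1) by (auto simp: B_symbols_def elim: quotientE)
  then obtain a b where ab: "A \<in> barrays" "(shift ^^ a) X = (shift ^^ b) A"
    using assms(2) by (auto simp: shift_equiv_def)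
  then show "A \<in> barrays" by simp
  have "(shift ^^ (i + a)) X = (shift ^^ (i + b)) A" using ab(2) by (simp add: funpow_add)
  also have "\<dots> = (shift ^^ b) ((shift ^^ i) A)" unfolding add.commute[of i b] by (simp add: funpow_add)
  finally have "(X, (shift ^^ i) A) \<in> shift_equiv"
    unfolding shift_equiv_def using X(1) funpow_shift_barrays[OF ab(1), of i] by blast
  then show "(shift ^^ i) A \<in> L" using X(2) by simp
qed

text \<open>Each shift lengthens both rows by one, so equal sizes force equal numbers of shifts,
  which cancel by injectivity.\<close>

lemma B_symbols_same_size:
  assumes "L \<in> B_symbols" "A \<in> L" "B \<in> L" "length (snd A) = length (snd B)"
  shows "A = B"
proof -
  obtain X where X: "L = shift_equiv `` {X}" using assms(1) by (auto simp: B_symbols_def elim: quotientE)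
  then have "(A, B) \<in> shift_equiv" using assms(2,3) equiv_shift_equiv
    by (metis Image_singleton_iff equivE symE transE)
  then obtain i j where ij: "(shift ^^ i) A = (shift ^^ j) B" by (auto simp: shift_equiv_def)
  then have "i = j" using length_snd_funpow_shift[of i A] length_snd_funpow_shift[of j B] assms(4) by simp
  then show ?thesis using ij inj_fn[OF inj_shift] by (auto dest: injD)
qed

fun weave :: "'a list \<Rightarrow> 'a list \<Rightarrow> 'a list" where
  "weave (l # ls) (m # ms) = l # m # weave ls ms"
| "weave ls [] = ls"
| "weave [] ms = ms"

lemma mset_weave: "mset (weave ls ms) = mset ls + mset ms"
  by (induction ls ms rule: weave.induct) auto

lemma sorted_weave:
  assumes "length ls = Suc (length ms)" "\<forall>i < length ms. ls ! i \<le> ms ! i \<and> ms ! i \<le> ls ! Suc i"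
  shows "sorted (weave ls ms) \<and> hd (weave ls ms) = (hd ls :: nat)"
  using assms
proof (induction ls ms rule: weave.induct)
  case (1 l ls m ms)
  have "sorted (weave ls ms) \<and> hd (weave ls ms) = hd ls" using 1 by fastforce
  moreover have "l \<le> m" "m \<le> hd ls" "ls \<noteq> []" "weave ls ms \<noteq> []"
    using 1(2,3) by (force simp: hd_conv_nth length_Suc_conv, fastforce simp: hd_conv_nth length_Suc_conv, auto simp: length_Suc_conv)
      (cases ms; auto simp: length_Suc_conv)
  ultimately show ?case by (cases "weave ls ms") auto
qed (auto simp: length_Suc_conv)

lemma weave_inject:
  "weave ls ms = weave ls' ms' \<Longrightarrow> length ls = Suc (length ms) \<Longrightarrow> length ls' = Suc (length ms') \<Longrightarrow>
   length ms = length ms' \<Longrightarrow> ls = ls' \<and> ms = ms'"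
proof (induction ls ms arbitrary: ls' ms' rule: weave.induct)
  case (1 l ls m ms)
  then show ?case by (cases ls'; cases ms') auto
qed auto

text \<open>An array is special when interleaving its rows gives a sorted list. Such a list is
  determined by its multiset and splits back into the two rows in only one way.\<close>

lemma special_array_unique:
  assumes "A \<in> barrays" "B \<in> barrays" "special_array A" "special_array B" "entries A = entries B"
  shows "A = B"
proof -
  have "sorted (weave (fst A) (snd A))" "sorted (weave (fst B) (snd B))"
    using assms by (auto simp: barrays_def special_array_def sorted_weave)
  moreover have "mset (weave (fst A) (snd A)) = mset (weave (fst B) (snd B))"
    using assms(5) by (simp add: mset_weave entries_def)
  ultimately have "weave (fst A) (snd A) = weave (fst B) (snd B)" by (metis properties_for_sort)
  moreover have "length (snd A) = length (snd B)"
    using size_entries[OF assms(1)] size_entries[OF assms(2)] assms(5) by simp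
  ultimately show ?thesis using weave_inject[of "fst A" "snd A" "fst B" "snd B"] assms(1,2)
    by (auto simp: barrays_def prod_eq_iff)
qed

definition special_pair :: "nat list \<Rightarrow> nat list \<Rightarrow> nat \<Rightarrow> barray \<Rightarrow> barray \<Rightarrow> bool" where
  "special_pair p d M A B \<longleftrightarrow> A \<in> barrays \<and> B \<in> barrays \<and>
     doubled_entries A = beta_numbers (2 * M + 1) p \<and> doubled_entries B = beta_numbers (2 * M + 1) d \<and>
     entries B = entries A \<and> special_array B \<and> length d \<le> 2 * M + 1"

lemma special_pair_unique:
  assumes "special_pair p d M A B" "special_pair p d' M A' B'" "is_partition d" "is_partition d'"
  shows "d = d'"
proof -
  have "A = A'" using assms(1,2) by (auto simp: special_pair_def intro: doubled_entries_inject)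
  then have "B = B'" using assms(1,2) by (auto simp: special_pair_def intro: special_array_unique)
  then show ?thesis using assms by (intro beta_numbers_inject[of d d' "2 * M + 1"]) (auto simp: special_pair_def)
qed

text \<open>Shifting to a common size identifies the representatives of each class. All large
  \<open>M\<close> are provided so that two candidates for the special partition can be compared at
  the same size.\<close>

lemma special_partition_arrays:
  assumes "is_partition p" "is_special_partition_of n p d"
  shows "\<exists>M0. \<forall>M\<ge>M0. \<exists>A B. special_pair p d M A B"
proof -
  obtain L S where LS: "symbol_of_domino p L" "special_symbol_of L S" "symbol_of_type_C d S"
    using assms by (auto simp: is_special_partition_of_def)
  obtain m A1 where A1: "L \<in> B_symbols" "A1 \<in> L" "part p (2 * m + 2) = 0" "doubled_entries A1 = beta_numbers (2 * m + 1) p"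
    using LS(1) by (auto simp: symbol_of_domino_def)
  obtain A2 B2 where A2: "S \<in> B_symbols" "A2 \<in> L" "B2 \<in> S" "entries B2 = entries A2" "special_array B2"
    using LS(2) by (auto simp: special_symbol_of_def)
  obtain k C where C: "C \<in> S" "doubled_entries C = beta_numbers (2 * k + 1) d" "length d \<le> 2 * k + 1"
  proof -
    let ?K = "if odd (length d) then length d else length d + 1"
    obtain C where "C \<in> S" "doubled_entries C = beta_numbers ?K d"
      using LS(3) by (auto simp: symbol_of_type_C_def Let_def)
    moreover have "?K = 2 * (length d div 2) + 1" by presburger
    moreover have "length d \<le> 2 * (length d div 2) + 1" by presburger
    ultimately show thesis using that by metis
  qed
  have lp: "length p \<le> 2 * m + 1" using A1(3) part_eq_0_iff[OF assms(1), of "2 * m + 2"] by simp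
  note bar = B_symbols_memD(1)[OF A1(1,2)] B_symbols_memD(1)[OF A1(1) A2(2)]
    B_symbols_memD(1)[OF A2(1,3)] B_symbols_memD(1)[OF A2(1) C(1)]
  have l: "length (snd A1) = m" "length (snd B2) = length (snd A2)" "length (snd C) = k"
    using size_doubled_entries[OF bar(1)] A1(4) size_entries[OF bar(2)] size_entries[OF bar(3)] A2(4)
      size_doubled_entries[OF bar(4)] C(2) by (simp_all add: size_beta_numbers)
  show ?thesis
  proof (rule exI, rule allI, rule impI)
    fix M assume M: "m + length (snd A2) + k \<le> M"
    let ?A = "(shift ^^ (M - m)) A1" and ?A' = "(shift ^^ (M - length (snd A2))) A2"
      and ?B = "(shift ^^ (M - length (snd A2))) B2" and ?C = "(shift ^^ (M - k)) C"
    have "?A = ?A'"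
      by (rule B_symbols_same_size[OF A1(1)])
        (use B_symbols_memD(2)[OF A1(1,2)] B_symbols_memD(2)[OF A1(1) A2(2)] l M in \<open>auto simp: length_snd_funpow_shift\<close>)
    moreover have "?B = ?C"
      by (rule B_symbols_same_size[OF A2(1)])
        (use B_symbols_memD(2)[OF A2(1,3)] B_symbols_memD(2)[OF A2(1) C(1)] l M in \<open>auto simp: length_snd_funpow_shift\<close>)
    moreover have "doubled_entries ?A = beta_numbers (2 * M + 1) p"
      using doubled_entries_funpow_shift[OF A1(4) lp, of "M - m"] M by (simp add: algebra_simps)
    moreover have "doubled_entries ?C = beta_numbers (2 * M + 1) d"
      using doubled_entries_funpow_shift[OF C(2,3), of "M - k"] M by (simp add: algebra_simps)
    moreover have "entries ?B = entries ?A'" using A2(4) by (rule entries_funpow_shift)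
    moreover have "special_array ?B" using bar(3) A2(5) by (rule special_funpow_shift)
    moreover have "length d \<le> 2 * M + 1" using C(3) M by simp
    ultimately have "special_pair p d M ?A' ?B"
      unfolding special_pair_def using funpow_shift_barrays bar by metis
    then show "\<exists>A B. special_pair p d M A B" by blast
  qed
qed

lemma special_partition_unique:
  assumes "is_partition p" "is_special_partition_of n p d" "is_special_partition_of n p d'"
  shows "d = d'"
proof -
  obtain M0 where M0: "\<And>M. M0 \<le> M \<Longrightarrow> \<exists>A B. special_pair p d M A B"
    using special_partition_arrays[OF assms(1,2)] by blast
  obtain M0' where M0': "\<And>M. M0' \<le> M \<Longrightarrow> \<exists>A B. special_pair p d' M A B"
    using special_partition_arrays[OF assms(1,3)] by blast
  have "is_partition d" "is_partition d'"
    using assms(2,3) by (auto simp: is_special_partition_of_def type_C_def is_partition_of_def)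
  then show ?thesis
    using M0[OF max.cobounded1[of M0 M0']] M0'[OF max.cobounded2[of M0' M0]] special_pair_unique by blast
qed

section \<open>The special partition\<close>

text \<open>
  Two equal odd parts in rows \<open>k\<close>, \<open>k + 1\<close> with \<open>k\<close> odd give coinciding entries of the
  special symbol, which then appear in the wrong order; swapping them keeps both parts.
\<close>

definition swapped :: "nat list \<Rightarrow> nat \<Rightarrow> bool" where
  "swapped p k \<longleftrightarrow> odd k \<and> odd (part p k) \<and> part p (k + 1) = part p k"

definition special_part :: "nat list \<Rightarrow> nat \<Rightarrow> nat" where
  "special_part p k =
     (if swapped p k \<or> even k \<and> swapped p (k - 1) then part p k
      else if odd k then 2 * (part p k div 2) else 2 * ((part p k + 1) div 2))"

lemma swapped_odd: "swapped p k \<Longrightarrow> odd k"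
  by (simp add: swapped_def)

lemma swapped_le_length:
  assumes "swapped p k"
  shows "k + 1 \<le> length p"
proof -
  have "part p (k + 1) \<noteq> 0" using assms unfolding swapped_def by (metis even_zero)
  then show ?thesis by (simp add: part_def split: if_splits)
qed

text \<open>Only the step from an odd row to the next is critical, since there the upper part is
  rounded down and the lower one up. This would fail only for two equal odd parts, which is the
  exception made for swapped pairs.\<close>

lemma special_part_antimono:
  assumes "is_partition p" "1 \<le> k"
  shows "special_part p (Suc k) \<le> special_part p k"
proof -
  have le: "part p (Suc k) \<le> part p k" using assms by (intro part_antimono) auto
  show ?thesis
  proof (cases "odd k")
    case True
    then have "swapped p (Suc k) = False" by (simp add: swapped_def)
    show ?thesis
    proof (cases "swapped p k")
      case True
      then show ?thesis using le by (simp add: special_part_def swapped_def)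
    next
      case False
      then have "even (part p k) \<or> part p (Suc k) < part p k" using True le by (auto simp: swapped_def)
      then have "2 * ((part p (Suc k) + 1) div 2) \<le> 2 * (part p k div 2)" using le by presburger
      then show ?thesis using True False \<open>swapped p (Suc k) = False\<close> by (simp add: special_part_def)
    qed
  next
    case False
    then have "part p k \<le> special_part p k" by (simp add: special_part_def) presburger
    moreover have "special_part p (Suc k) \<le> part p (Suc k)" using False by (simp add: special_part_def)
    ultimately show ?thesis using le by simp
  qed
qed

lemma special_part_zero: "length p < k \<Longrightarrow> special_part p k = 0"
  by (simp add: special_part_def part_def)

lemma ex_special_parts:
  assumes "is_partition p"
  obtains d where "is_partition d" "length d \<le> length p" "\<And>k. 1 \<le> k \<Longrightarrow> part d k = special_part p k"
proof -
  have "\<exists>d. is_partition d \<and> length d \<le> length p \<and> (\<forall>k \<ge> 1. part d k = special_part p k)"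
    by (rule ex_partition_of_antimono) (rule special_part_antimono[OF assms], assumption, rule special_part_zero)
  then show thesis using that by auto
qed

lemma count_list_part:
  assumes "length d \<le> K" "0 < x"
  shows "count_list d x = card {k \<in> {1..K}. part d k = x}"
proof -
  have "count_list d x = card {i. i < length d \<and> d ! i = x}"
    by (simp add: count_list_eq_length_filter length_filter_conv_card eq_commute[of x])
  also have "\<dots> = card (Suc ` {i. i < length d \<and> d ! i = x})" by (simp add: card_image)
  also have "Suc ` {i. i < length d \<and> d ! i = x} = {k \<in> {1..K}. part d k = x}"
  proof (intro equalityI subsetI)
    fix k assume "k \<in> {k \<in> {1..K}. part d k = x}"
    then have "k - 1 \<in> {i. i < length d \<and> d ! i = x}" "k = Suc (k - 1)"
      using assms(2) by (auto simp: part_def split: if_splits)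
    then show "k \<in> Suc ` {i. i < length d \<and> d ! i = x}" by blast
  qed (use assms in \<open>auto simp: part_def\<close>)
  finally show ?thesis .
qed

text \<open>Rounding produces even numbers, so odd parts arise only from swapped pairs, each
  contributing the same part in two adjacent rows.\<close>

lemma even_count_special_part:
  assumes "length d \<le> K" "odd x" "\<And>k. 1 \<le> k \<Longrightarrow> part d k = special_part p k" "length p \<le> K"
  shows "even (count_list d x)"
proof -
  let ?S = "{k \<in> {1..K}. swapped p k \<and> part p k = x}"
  have S: "Suc k \<le> K" if "k \<in> ?S" for k using swapped_le_length[of p k] assms(4) that by simp
  have eq: "{k \<in> {1..K}. part d k = x} = ?S \<union> Suc ` ?S"
  proof (intro equalityI subsetI)
    fix k assume k: "k \<in> {k \<in> {1..K}. part d k = x}"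
    then have "special_part p k = x" using assms(3)[of k] by simp
    then have sw: "swapped p k \<or> even k \<and> swapped p (k - 1)"
      using assms(2) unfolding special_part_def by (metis dvd_triv_left)
    then have "part p k = x" using \<open>special_part p k = x\<close> unfolding special_part_def by metis
    note this sw
    moreover have "k \<in> Suc ` ?S" if "even k" "swapped p (k - 1)"
    proof
      show "k = Suc (k - 1)" using k by simp
      have "k \<noteq> 1" using that(1) by auto
      then have "1 \<le> k - 1" "k - 1 \<le> K" "k - 1 + 1 = k" using k by auto
      then show "k - 1 \<in> ?S" using that(2) \<open>part p k = x\<close> by (simp add: swapped_def)
    qed
    ultimately show "k \<in> ?S \<union> Suc ` ?S" using k by auto
  next
    fix k assume "k \<in> ?S \<union> Suc ` ?S"
    then show "k \<in> {k \<in> {1..K}. part d k = x}"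
    proof
      assume "k \<in> ?S"
      then show ?thesis using assms(3) by (simp add: special_part_def)
    next
      assume "k \<in> Suc ` ?S"
      then obtain j where j: "k = Suc j" "j \<in> ?S" by blast
      then have "even k \<and> swapped p (k - 1)" "part p k = x"
        using swapped_odd[of p j] unfolding swapped_def by auto
      then have "special_part p k = x" unfolding special_part_def by metis
      then show ?thesis using assms(3) S[OF j(2)] j by simp
    qed
  qed
  have "card (?S \<union> Suc ` ?S) = card ?S + card (Suc ` ?S)"
  proof (rule card_Un_disjoint)
    show "?S \<inter> Suc ` ?S = {}" by (auto dest!: swapped_odd)
  qed auto
  moreover have "count_list d x = card {k \<in> {1..K}. part d k = x}"
    using count_list_part[OF assms(1)] assms(2) odd_pos by blast
  ultimately have "count_list d x = card ?S + card (Suc ` ?S)" by (simp only: eq)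
  then show ?thesis by (simp add: card_image)
qed

section \<open>The special array and its partition\<close>

definition half_beta :: "nat \<Rightarrow> nat list \<Rightarrow> nat \<Rightarrow> nat" where
  "half_beta K p k = beta K p k div 2"

text \<open>
  The sorted entries are \<open>half_beta K p K \<le> \<dots> \<le> half_beta K p 1\<close>; the special array puts those with
  odd index into the first row.
\<close>

definition special_barray :: "nat \<Rightarrow> nat list \<Rightarrow> barray" where
  "special_barray m p =
     (map (\<lambda>i. half_beta (2 * m + 1) p (2 * m + 1 - 2 * i)) [0..<m + 1],
      map (\<lambda>i. half_beta (2 * m + 1) p (2 * m - 2 * i)) [0..<m])"

lemma half_beta_mono:
  assumes "is_partition p" "1 \<le> i" "i \<le> j" "j \<le> K"
  shows "half_beta K p j \<le> half_beta K p i"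
  using beta_gap[OF assms] by (simp add: half_beta_def div_le_mono)

lemma half_beta_strict:
  assumes "is_partition p" "1 \<le> i" "i + 2 \<le> j" "j \<le> K"
  shows "half_beta K p j < half_beta K p i"
proof -
  have "beta K p j + 2 \<le> beta K p i" using beta_gap[of p i j K] assms by simp
  then show ?thesis unfolding half_beta_def by presburger
qed

lemma special_barray_barrays:
  assumes "is_partition p"
  shows "special_barray m p \<in> barrays"
proof -
  have "sorted_wrt (<) (map (\<lambda>i. half_beta (2 * m + 1) p (2 * m + 1 - 2 * i)) [0..<m + 1])"
    unfolding sorted_wrt_iff_nth_less
    by (auto simp del: upt_Suc intro!: half_beta_strict[OF assms])
  moreover have "sorted_wrt (<) (map (\<lambda>i. half_beta (2 * m + 1) p (2 * m - 2 * i)) [0..<m])"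
    unfolding sorted_wrt_iff_nth_less
    by (auto simp del: upt_Suc intro!: half_beta_strict[OF assms])
  ultimately show ?thesis by (simp add: special_barray_def barrays_def del: upt_Suc)
qed

lemma special_barray_special:
  assumes "is_partition p"
  shows "special_array (special_barray m p)"
  unfolding special_array_def special_barray_def fst_conv snd_conv
proof (intro allI impI)
  let ?h = "half_beta (2 * m + 1) p"
  fix i assume "i < length (map (\<lambda>i. ?h (2 * m - 2 * i)) [0..<m])"
  then have i: "i < m" by simp
  have "?h (2 * m + 1 - 2 * i) \<le> ?h (2 * m - 2 * i)"
    by (rule half_beta_mono[OF assms]) (use i in auto)
  moreover have "?h (2 * m - 2 * i) \<le> ?h (2 * m + 1 - 2 * Suc i)"
    by (rule half_beta_mono[OF assms]) (use i in auto)
  ultimately show "map (\<lambda>i. ?h (2 * m + 1 - 2 * i)) [0..<m + 1] ! i \<le> map (\<lambda>i. ?h (2 * m - 2 * i)) [0..<m] ! i \<and>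
    map (\<lambda>i. ?h (2 * m - 2 * i)) [0..<m] ! i \<le> map (\<lambda>i. ?h (2 * m + 1 - 2 * i)) [0..<m + 1] ! Suc i"
    using i by (simp del: upt_Suc)
qed

lemma doubled_entries_special_barray:
  "doubled_entries (special_barray m p) =
     image_mset (\<lambda>k. 2 * half_beta (2 * m + 1) p k + (if even k then 1 else 0)) (mset_set {1..2 * m + 1})"
proof -
  let ?f = "\<lambda>i. 2 * m + 1 - 2 * i" and ?g = "\<lambda>i. 2 * m - 2 * i"
  let ?F = "?f ` {0..<m + 1}" and ?G = "?g ` {0..<m}"
  have K: "{1..2 * m + 1} = ?F \<union> ?G"
  proof (intro equalityI subsetI)
    fix k assume k: "k \<in> {1..2 * m + 1}"
    show "k \<in> ?F \<union> ?G"
    proof (cases "odd k")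
      case True
      then obtain t where "k = 2 * t + 1" by (elim oddE)
      then have "k = ?f (m - t)" "m - t \<in> {0..<m + 1}" using k by auto
      then show ?thesis by blast
    next
      case False
      then obtain t where "k = 2 * t" by (auto elim: evenE)
      then have "k = ?g (m - t)" "m - t \<in> {0..<m}" using k by auto
      then show ?thesis by blast
    qed
  qed auto
  have "odd k" if "k \<in> ?F" for k using that by (auto simp del: One_nat_def)
  moreover have "even k" if "k \<in> ?G" for k using that by auto
  ultimately have par: "\<And>k. k \<in> ?F \<Longrightarrow> odd k" "\<And>k. k \<in> ?G \<Longrightarrow> even k" by blast+
  have "mset_set {1..2 * m + 1} = mset_set ?F + mset_set ?G"
    unfolding K by (rule mset_set_Union) (use par in blast)+
  also have "\<dots> = image_mset ?f (mset_set {0..<m + 1}) + image_mset ?g (mset_set {0..<m})"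
  proof -
    have "inj_on ?f {0..<m + 1}" "inj_on ?g {0..<m}" by (auto simp: inj_on_def)
    then show ?thesis by (simp only: image_mset_mset_set)
  qed
  finally have "image_mset (\<lambda>k. 2 * half_beta (2 * m + 1) p k + (if even k then 1 else 0)) (mset_set {1..2 * m + 1})
    = image_mset (\<lambda>i. 2 * half_beta (2 * m + 1) p (?f i) + (if even (?f i) then 1 else 0)) (mset_set {0..<m + 1})
    + image_mset (\<lambda>i. 2 * half_beta (2 * m + 1) p (?g i) + (if even (?g i) then 1 else 0)) (mset_set {0..<m})"
    by (simp only: image_mset_union multiset.map_comp o_def)
  also have "image_mset (\<lambda>i. 2 * half_beta (2 * m + 1) p (?f i) + (if even (?f i) then 1 else 0)) (mset_set {0..<m + 1})
    = image_mset (\<lambda>i. 2 * half_beta (2 * m + 1) p (?f i)) (mset_set {0..<m + 1})"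
    by (rule image_mset_cong) (use par(1) in auto)
  also have "image_mset (\<lambda>i. 2 * half_beta (2 * m + 1) p (?g i) + (if even (?g i) then 1 else 0)) (mset_set {0..<m})
    = image_mset (\<lambda>i. 2 * half_beta (2 * m + 1) p (?g i) + 1) (mset_set {0..<m})"
    by (rule image_mset_cong) (use par(2) in auto)
  finally show ?thesis
    unfolding doubled_entries_def special_barray_def fst_conv snd_conv mset_map mset_upt multiset.map_comp o_def by simp
qed

lemma entries_special_barray:
  "entries (special_barray m p) = image_mset (\<lambda>x. x div 2) (beta_numbers (2 * m + 1) p)"
proof -
  have "entries (special_barray m p) =
    image_mset (\<lambda>k. (2 * half_beta (2 * m + 1) p k + (if even k then 1 else 0)) div 2) (mset_set {1..2 * m + 1})"
    unfolding entries_doubled doubled_entries_special_barray multiset.map_comp o_def ..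
  also have "\<dots> = image_mset (half_beta (2 * m + 1) p) (mset_set {1..2 * m + 1})"
    by (rule image_mset_cong) auto
  finally show ?thesis
    unfolding beta_numbers_alt multiset.map_comp by (simp add: half_beta_def[abs_def] o_def)
qed

text \<open>The offset \<open>2 * m + 1 - k\<close> is even for odd \<open>k\<close> and odd for
  even \<open>k\<close>, so halving and doubling back rounds the part down or up accordingly. At a
  swapped pair the halves coincide, and the larger doubled entry has the larger index; the
  involution \<sigma> restores the decreasing order.\<close>

lemma doubled_entries_special_parts:
  assumes "length p \<le> 2 * m + 1" "\<And>k. 1 \<le> k \<Longrightarrow> part d k = special_part p k"
  shows "doubled_entries (special_barray m p) = beta_numbers (2 * m + 1) d"
proof -
  let ?K = "2 * m + 1"
  define \<sigma> where "\<sigma> k = (if swapped p k then k + 1 else if even k \<and> swapped p (k - 1) then k - 1 else k)" for k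
  have sK: "k + 1 \<le> length p" "odd k" "\<not> swapped p (k + 1)" "0 < k" if "swapped p k" for k
    using that swapped_le_length by (auto simp: swapped_def odd_pos)
  have \<sigma>: "\<sigma> k \<in> {1..?K} \<and> \<sigma> (\<sigma> k) = k" if "k \<in> {1..?K}" for k
  proof (cases "swapped p k")
    case True
    then show ?thesis using sK[OF True] assms(1) by (simp add: \<sigma>_def)
  next
    case False
    note nsw = this
    show ?thesis
    proof (cases "even k \<and> swapped p (k - 1)")
      case True
      then show ?thesis using nsw sK[of "k - 1"] that by (auto simp: \<sigma>_def)
    next
      case False
      then have "\<sigma> k = k" using nsw unfolding \<sigma>_def by auto
      then show ?thesis using that by simp
    qed
  qed
  have "bij_betw \<sigma> {1..?K} {1..?K}" by (rule bij_betw_byWitness[where f' = \<sigma>]) (use \<sigma> in blast)+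
  then have "mset_set {1..?K} = image_mset \<sigma> (mset_set {1..?K})"
    by (metis bij_betw_def image_mset_mset_set)
  then have "doubled_entries (special_barray m p) =
     image_mset (\<lambda>k. 2 * half_beta ?K p (\<sigma> k) + (if even (\<sigma> k) then 1 else 0)) (mset_set {1..?K})"
    unfolding doubled_entries_special_barray by (metis (no_types, lifting) multiset.map_comp o_def image_mset_cong)
  also have "\<dots> = image_mset (beta ?K d) (mset_set {1..?K})"
  proof (rule image_mset_cong)
    fix k assume "k \<in># mset_set {1..?K}"
    then have k: "1 \<le> k" "k \<le> ?K" by auto
    have dk: "beta ?K d k = special_part p k + ?K - k" using assms(2)[OF k(1)] by (simp add: beta_def)
    consider (1) "swapped p k" | (2) "\<not> swapped p k" "even k" "swapped p (k - 1)"
      | (3) "\<not> swapped p k" "\<not> (even k \<and> swapped p (k - 1))" by blast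
    then show "2 * half_beta ?K p (\<sigma> k) + (if even (\<sigma> k) then 1 else 0) = beta ?K d k"
    proof cases
      case 1
      have "k + 1 \<le> ?K" using sK(1)[OF 1] assms(1) by simp
      moreover obtain t u where "k = 2 * t + 1" "part p k = 2 * u + 1" using 1 by (auto simp: swapped_def elim!: oddE)
      ultimately show ?thesis using 1 unfolding dk
        by (simp add: \<sigma>_def special_part_def half_beta_def beta_def swapped_def)
    next
      case 2
      then obtain t where t: "k = 2 * t" "t > 0" using k by (auto elim: evenE)
      moreover have "part p (k - 1) = part p k" "odd (part p k)" using 2 k by (auto simp: swapped_def)
      moreover from this obtain u where "part p k = 2 * u + 1" by (elim oddE)
      moreover obtain v where "m = t + v" using k t(1) le_Suc_ex by fastforce
      ultimately show ?thesis using 2 unfolding dk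
        by (simp add: \<sigma>_def special_part_def half_beta_def beta_def)
    next
      case 3
      show ?thesis
      proof (cases "odd k")
        case True
        then obtain t where t: "k = 2 * t + 1" by (elim oddE)
        then obtain v where v: "m = t + v" using k(2) le_Suc_ex by fastforce
        have "\<sigma> k = k" using 3 unfolding \<sigma>_def by auto
        moreover have "special_part p k = 2 * (part p k div 2)" using 3 True by (simp add: special_part_def)
        moreover have "part p k + ?K - k = part p k + 2 * v" "2 * (part p k div 2) + ?K - k = 2 * (part p k div 2) + 2 * v"
          using t v by auto
        ultimately show ?thesis using True unfolding dk by (simp add: half_beta_def beta_def)
      next
        case False
        then obtain t where t: "k = 2 * t" by (auto elim: evenE)
        then obtain v where v: "m = t + v" using k(2) le_Suc_ex by fastforce
        have "\<sigma> k = k" using 3 unfolding \<sigma>_def by auto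
        moreover have "special_part p k = 2 * ((part p k + 1) div 2)" using 3 False by (simp add: special_part_def)
        moreover have "part p k + ?K - k = (part p k + 1) + 2 * v"
          "2 * ((part p k + 1) div 2) + ?K - k = 2 * ((part p k + 1) div 2) + 2 * v + 1"
          using t v by auto
        moreover have "(part p k + 1 + 2 * v) div 2 = (part p k + 1) div 2 + v" by simp
        ultimately show ?thesis using False unfolding dk unfolding half_beta_def beta_def by simp
      qed
    qed
  qed
  finally show ?thesis by (simp add: beta_numbers_alt)
qed

lemma B_symbol_of: "A \<in> barrays \<Longrightarrow> shift_equiv `` {A} \<in> B_symbols \<and> A \<in> shift_equiv `` {A}"
  unfolding B_symbols_def by (intro conjI quotientI equiv_class_self[OF equiv_shift_equiv])

lemma is_special_partition_special_parts:
  assumes p: "is_partition_of (2 * n) p" "balance p = 0"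
    and d: "is_partition d" "length d \<le> length p" "\<And>k. 1 \<le> k \<Longrightarrow> part d k = special_part p k"
  shows "is_special_partition_of n p d"
proof -
  define m where "m = length p"
  let ?K = "2 * m + 1" and ?B = "special_barray m p"
  have pp: "is_partition p" "sum_list p = 2 * n" using p by (auto simp: is_partition_of_def)
  have B: "?B \<in> barrays" "special_array ?B" "doubled_entries ?B = beta_numbers ?K d"
    using special_barray_barrays special_barray_special doubled_entries_special_parts[of p m d] pp(1) d(3)
    by (auto simp: m_def)
  obtain A where A: "A \<in> barrays" "doubled_entries A = beta_numbers ?K p"
    using ex_barray_beta_numbers[OF pp(1) p(2), of ?K] by (auto simp: m_def)
  have eBA: "entries ?B = entries A" using entries_special_barray entries_doubled A(2) by metis
  \<comment> \<open>The array \<open>?B\<close> realises the beta numbers of \<open>d\<close> at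
    size \<open>?K\<close>, but \<open>symbol_of_type_C\<close> prescribes the size
    \<open>K'\<close>. Balance 0 yields an array \<open>C\<close> of that size, and shifting it up
    gives \<open>?B\<close>.\<close>
  have bd: "balance d = 0"
    using sign_sum_doubled_entries[OF B(1)] sign_sum_beta_numbers[of d ?K] B(3) d(2) by (simp add: m_def)
  define K' where "K' = (if odd (length d) then length d else length d + 1)"
  have K': "odd K'" "length d \<le> K'" "K' \<le> ?K" using d(2) by (auto simp: K'_def m_def)
  obtain C where C: "C \<in> barrays" "doubled_entries C = beta_numbers K' d"
    using ex_barray_beta_numbers[OF d(1) bd K'(2,1)] by blast
  obtain i where i: "?K = K' + 2 * i"
  proof -
    have "even (?K - K')" using K' by simp
    then obtain i where "?K - K' = 2 * i" by (elim evenE)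
    then show thesis using that[of i] K'(3) by simp
  qed
  have "(shift ^^ i) C = ?B"
    by (rule doubled_entries_inject) (use doubled_entries_funpow_shift[OF C(2) K'(2), of i] i B C funpow_shift_barrays in auto)
  then have "(shift ^^ 0) ?B = (shift ^^ i) C" by simp
  then have "(?B, C) \<in> shift_equiv" unfolding shift_equiv_def using B(1) C(1) by blast
  then have tC: "symbol_of_type_C d (shift_equiv `` {?B})"
    using C(2) B_symbol_of[OF B(1)] unfolding symbol_of_type_C_def K'_def[symmetric] Let_def by auto
  have dom: "symbol_of_domino p (shift_equiv `` {A})"
    unfolding symbol_of_domino_def using B_symbol_of[OF A(1)] A(2) by (auto intro!: exI[of _ m] simp: part_def m_def)
  have sp: "special_symbol_of (shift_equiv `` {A}) (shift_equiv `` {?B})"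
    unfolding special_symbol_of_def using B_symbol_of[OF A(1)] B_symbol_of[OF B(1)] eBA B(2) by blast
  have "length (snd A) = length (snd ?B)"
    using size_entries[OF A(1)] size_entries[OF B(1)] eBA by simp
  \<comment> \<open>Beta numbers exceed the parts in total by a constant that depends only on
    \<open>?K\<close>, so equal sums make \<open>d\<close> a partition of
    \<open>2 * n\<close>.\<close>
  then have "\<Sum>\<^sub># (beta_numbers ?K p) = \<Sum>\<^sub># (beta_numbers ?K d)"
    using sum_doubled_entries[of A] sum_doubled_entries[of ?B] eBA A(2) B(3) by simp
  moreover have "\<Sum>\<^sub># (beta_numbers ?K q) = sum_list q + (\<Sum>k=1..?K. ?K - k)" if "length q \<le> ?K" for q
  proof -
    have "\<Sum>\<^sub># (beta_numbers ?K q) = (\<Sum>k=1..?K. part q k + ?K - k)"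
      unfolding beta_numbers_def sum_unfold_sum_mset ..
    also have "\<dots> = (\<Sum>k=1..?K. part q k + (?K - k))" by (rule sum.cong) auto
    finally show ?thesis by (simp only: sum.distrib sum_list_part[OF that])
  qed
  ultimately have "sum_list d = 2 * n" using pp(2) d(2) by (simp add: m_def)
  moreover have "even (count_list d x)" if "odd x" for x
    by (rule even_count_special_part[of d ?K x p]) (use that d m_def in auto)
  ultimately have "type_C n d" using d(1) by (simp add: type_C_def is_partition_of_def)
  then show ?thesis unfolding is_special_partition_of_def using dom sp tC by blast
qed

section \<open>The H-algorithm\<close>

text \<open>Skipped pairs cannot overlap, because the ends of equal consecutive rows alternate in
  parity. A complete pair withholds two labels, so the parity is off only at the first row of a
  pair.\<close>

lemma even_row_label:
  assumes "i \<le> length p"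
  shows "even (row_label p i) \<longleftrightarrow> (if skipped_pair p i then odd i else even i)"
  using assms
proof (induction i)
  case (Suc i)
  have "{j \<in> {1..Suc i}. labeled_row p j} =
    (if labeled_row p (Suc i) then insert (Suc i) else id) {j \<in> {1..i}. labeled_row p j}"
    by (auto simp: le_Suc_eq)
  then have "row_label p (Suc i) = (if labeled_row p (Suc i) then 1 else 0) + row_label p i"
    by (simp add: row_label_def)
  moreover have "labeled_row p (Suc i) \<longleftrightarrow> \<not> skipped_pair p (Suc i) \<and> \<not> skipped_pair p i"
    using Suc.prems by (auto simp: labeled_row_def skipped_pair_def)
  moreover have "\<not> (skipped_pair p (Suc i) \<and> skipped_pair p i)"
    by (auto simp: skipped_pair_def)
  ultimately show ?case using Suc by auto
qed (simp add: row_label_def skipped_pair_def)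

text \<open>For odd \<open>k\<close> the two notions agree. Skipped pairs starting in an even row
  have even parts, which rounding leaves alone, so \<open>special_part\<close> needs no exception
  for them.\<close>

lemma swapped_skipped: "swapped p k \<Longrightarrow> skipped_pair p k"
  using swapped_le_length[of p k] by (auto simp: swapped_def skipped_pair_def even_box_def odd_pos Suc_le_eq)

lemma odd_boxes_iff: "(k, l) \<in> odd_boxes p \<longleftrightarrow> 1 \<le> k \<and> 1 \<le> l \<and> l \<le> part p k \<and> odd (k + l)"
  by (auto simp: odd_boxes_def young_diagram_def even_box_def)

text \<open>In an even row the odd boxes occupy the odd columns, so the appended box lands in the
  column obtained by rounding the part up to an even number.\<close>

lemma Max_odd_boxes:
  assumes "even i" "1 \<le> i" "0 < part p i"
  shows "Max {l. (i, l) \<in> odd_boxes p} + 1 = 2 * ((part p i + 1) div 2)"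
proof -
  define c where "c = (part p i + 1) div 2"
  have c: "0 < c" "2 * c - 1 \<le> part p i" "part p i \<le> 2 * c" using assms(3) unfolding c_def by presburger+
  have "Max {l. (i, l) \<in> odd_boxes p} = 2 * c - 1"
  proof (rule Max_eqI)
    show "finite {l. (i, l) \<in> odd_boxes p}"
      by (rule finite_subset[of _ "{..part p i}"]) (auto simp: odd_boxes_iff)
    show "2 * c - 1 \<in> {l. (i, l) \<in> odd_boxes p}"
    proof -
      have "1 \<le> 2 * c - 1" "odd (i + (2 * c - 1))" using c(1) assms(1) by presburger+
      then show ?thesis using assms(2) c(2) by (simp add: odd_boxes_iff)
    qed
    fix l assume "l \<in> {l. (i, l) \<in> odd_boxes p}"
    then have "odd l" "l \<le> 2 * c" using assms(1) c by (auto simp: odd_boxes_iff)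
    then show "l \<le> 2 * c - 1" by presburger
  qed
  then show ?thesis using c(1) by (simp add: c_def)
qed

text \<open>A labeled row lies in no skipped pair, hence in no swapped one, so
  \<open>special_part\<close> rounds up in every even labeled row.\<close>

lemma mem_added_boxes_iff:
  assumes "is_partition p"
  shows "(i, l) \<in> added_boxes p \<longleftrightarrow> labeled_row p i \<and> even i \<and> 0 < part p i \<and> l = special_part p i"
proof -
  have *: "(even (row_label p i) \<longleftrightarrow> even i) \<and> 0 < part p i \<and>
      (even i \<longrightarrow> Max {l. (i, l) \<in> odd_boxes p} + 1 = special_part p i)" if i: "labeled_row p i"
  proof (intro conjI impI)
    have i': "1 \<le> i" "i \<le> length p" "\<not> skipped_pair p i" using i by (auto simp: labeled_row_def)
    show "even (row_label p i) \<longleftrightarrow> even i" using even_row_label[of i p] i' by simp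
    show pos: "0 < part p i" using part_eq_0_iff[OF assms i'(1)] i'(2) by simp
    assume "even i"
    then have "2 \<le> i" using i'(1) by presburger
    then have "\<not> swapped p (i - 1)" using i swapped_skipped by (auto simp: labeled_row_def)
    moreover have "\<not> swapped p i" using i'(3) swapped_skipped by blast
    ultimately show "Max {l. (i, l) \<in> odd_boxes p} + 1 = special_part p i"
      using Max_odd_boxes[OF \<open>even i\<close> i'(1) pos] \<open>even i\<close> by (simp add: special_part_def)
  qed
  have "(i, l) \<in> added_boxes p \<longleftrightarrow> labeled_row p i \<and> even (row_label p i) \<and> l = Max {l. (i, l) \<in> odd_boxes p} + 1"
    by (auto simp: added_boxes_def)
  then show ?thesis using * by metis
qed

lemma odd_box_le_special_part:
  assumes "(k, l) \<in> odd_boxes p"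
  shows "l \<le> special_part p k"
proof -
  have "l \<le> part p k" "odd (k + l)" using assms by (auto simp: odd_boxes_iff)
  moreover from this have "odd k \<Longrightarrow> l \<le> 2 * (part p k div 2)" "even k \<Longrightarrow> l \<le> 2 * ((part p k + 1) div 2)"
    by presburger+
  ultimately show ?thesis unfolding special_part_def by auto
qed

text \<open>The box ending each nonempty row of the expected diagram is itself an odd or added box,
  or else an odd box lies directly below it and forces it. The latter occurs in the first row of a
  skipped pair, where holes are filled: this is case 2 for odd \<open>k\<close> and subcase b of
  case 5 for even \<open>k\<close>.\<close>

lemma special_part_le_part:
  assumes p: "is_partition p" and q: "is_partition q"
    and X: "odd_boxes p \<union> added_boxes p \<subseteq> young_diagram q" and k: "1 \<le> k"
  shows "special_part p k \<le> part q k"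
proof -
  have row: "l \<le> part q i" if "(i, l) \<in> odd_boxes p \<union> added_boxes p" for i l
    using X that by (auto simp: young_diagram_def)
  have next_row: "l \<le> part q k" if "(k + 1, l) \<in> odd_boxes p" for l
    using row[of "k + 1" l] that part_antimono[OF q k, of "k + 1"] by simp
  consider (1) "special_part p k = 0" | (2) "swapped p k" | (3) "even k" "swapped p (k - 1)"
    | (4) "odd k" "\<not> swapped p k" "0 < special_part p k"
    | (5) "even k" "\<not> swapped p (k - 1)" "0 < special_part p k"
    by blast
  then show ?thesis
  proof cases
    case 2
    then have "(k + 1, part p k) \<in> odd_boxes p" by (auto simp: odd_boxes_iff swapped_def odd_pos Suc_le_eq)
    then show ?thesis using next_row 2 by (simp add: special_part_def)
  next
    case 3
    then have "part p (k - 1) = part p k" "odd (part p k)" using k by (auto simp: swapped_def)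
    then have "(k, part p k) \<in> odd_boxes p" using 3 k by (auto simp: odd_boxes_iff odd_pos Suc_le_eq)
    then show ?thesis using row 3 by (simp add: special_part_def)
  next
    case 4
    then have "special_part p k = 2 * (part p k div 2)" by (simp add: special_part_def)
    then have "(k, special_part p k) \<in> odd_boxes p" using 4 k by (auto simp: odd_boxes_iff)
    then show ?thesis using row by blast
  next
    case 5
    then have s: "special_part p k = 2 * ((part p k + 1) div 2)"
    proof -
      have "\<not> swapped p k" using 5(1) by (simp add: swapped_def)
      then show ?thesis using 5(1,2) unfolding special_part_def by auto
    qed
    then have pos: "0 < part p k" using 5(3) by (cases "part p k") auto
    then have kl: "k \<le> length p" using part_eq_0_iff[OF p k] by simp
    consider (a) "labeled_row p k" | (b) "skipped_pair p k" | (c) "skipped_pair p (k - 1)"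
      using k kl by (auto simp: labeled_row_def)
    then show ?thesis
    proof cases
      case a
      then have "(k, special_part p k) \<in> added_boxes p" using mem_added_boxes_iff[OF p] 5 pos by blast
      then show ?thesis using row by blast
    next
      case b
      then have "even (part p k)" "part p (k + 1) = part p k" using 5(1) by (auto simp: skipped_pair_def even_box_def)
      then have "(k + 1, part p k) \<in> odd_boxes p" "special_part p k = part p k"
        using 5(1) pos s by (auto simp: odd_boxes_iff)
      then show ?thesis using next_row by simp
    next
      case c
      then have "swapped p (k - 1)" using 5(1) k by (auto simp: skipped_pair_def even_box_def swapped_def)
      then show ?thesis using 5(2) by blast
    qed
  qed simp
qed

lemma H_algorithm_special_parts:
  assumes p: "is_partition p" and d: "is_partition d" "\<And>k. 1 \<le> k \<Longrightarrow> part d k = special_part p k"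
  shows "H_algorithm_C p = young_diagram d"
proof -
  have "b \<in> young_diagram d" if "b \<in> odd_boxes p \<union> added_boxes p" for b
  proof (cases b)
    case (Pair k l)
    show ?thesis
    proof (cases "b \<in> odd_boxes p")
      case True
      then show ?thesis using Pair odd_box_le_special_part[of k l p] d(2)[of k]
        by (auto simp: odd_boxes_iff young_diagram_def)
    next
      case False
      then have a: "labeled_row p k" "even k" "0 < part p k" "l = special_part p k"
        using that mem_added_boxes_iff[OF p] Pair by auto
      then have "1 \<le> k" by (auto simp: labeled_row_def)
      moreover have "1 \<le> l" using a unfolding special_part_def by auto
      ultimately show ?thesis using Pair a(4) d(2) by (simp add: young_diagram_def)
    qed
  qed
  then have sub: "odd_boxes p \<union> added_boxes p \<subseteq> young_diagram d" by blast
  have "young_diagram d \<subseteq> young_diagram q"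
    if "is_partition q" "odd_boxes p \<union> added_boxes p \<subseteq> young_diagram q" for q
    using special_part_le_part[OF p that] d(2) by (fastforce simp: young_diagram_def)
  then show ?thesis using sub d(1) unfolding H_algorithm_C_def fill_holes_def by blast
qed

theorem lemma8p8:
  fixes n :: nat and p :: "nat list"
  assumes "domino_type n p"
  shows "(\<exists>!d. is_special_partition_of n p d) \<and>
         H_algorithm_C p = young_diagram (special_partition n p)"
proof -
  have p: "is_partition_of (2 * n) p" "is_partition p"
    using assms by (auto simp: domino_type_def is_partition_of_def)
  obtain d where d: "is_partition d" "length d \<le> length p" "\<And>k. 1 \<le> k \<Longrightarrow> part d k = special_part p k"
    using ex_special_parts[OF p(2)] by blast
  have sp: "is_special_partition_of n p d"
    using is_special_partition_special_parts[OF p(1) domino_type_balance[OF assms] d] .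
  then have "special_partition n p = d"
    unfolding special_partition_def using special_partition_unique[OF p(2)] by blast
  then show ?thesis
    using sp special_partition_unique[OF p(2)] H_algorithm_special_parts[OF p(2) d(1,3)] by auto
qed

end
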